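(* Let $n\geq 2$ and let $A\subset \mathbb{R}^n$ be Borel with $\dim A > \frac{n+1}{2}$. Then there exists an $a\in A$ such that $$\mathcal L^1(\Pi^a(A)) >0.$$
   Context: $\dim$ denotes Hausdorff dimension and $\mathcal L^1$ is Lebesgue measure on $\mathbb{R}$. For $A\subset\mathbb{R}^n$ and $a\in\mathbb{R}^n$, $\Pi^a(A):=\{a\cdot y: y\in A\}\subset\mathbb{R}$, where $\cdot$ is the Euclidean dot product. *)

theory Defs
  imports "HOL-Analysis.Analysis"
begin

text \<open>
  The term \<open>diam(U)^s\<close> of a cover, with the convention that for \<open>s = 0\<close> every nonempty
  set counts 1 (in the library \<open>0 powr 0 = 0\<close>).  \<open>diameter\<close> is meaningful only for
  bounded sets, so covers below are required to consist of bounded sets.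
\<close>

definition diam_pow :: "real \<Rightarrow> 'a::metric_space set \<Rightarrow> ennreal" where
  "diam_pow s U = (if U = {} then 0 else if s = 0 then 1 else ennreal (diameter U powr s))"

definition hausdorff_premeasure :: "real \<Rightarrow> real \<Rightarrow> 'a::metric_space set \<Rightarrow> ennreal" where
  "hausdorff_premeasure s \<delta> A =
     (INF U \<in> {U :: nat \<Rightarrow> 'a set. A \<subseteq> (\<Union>i. U i) \<and>
                  (\<forall>i. bounded (U i) \<and> diameter (U i) \<le> \<delta>)}.
        (\<Sum>i. diam_pow s (U i)))"

text \<open>Unnormalised: constant factors do not affect the dimension.\<close>

definition hausdorff_measure :: "real \<Rightarrow> 'a::metric_space set \<Rightarrow> ennreal" where
  "hausdorff_measure s A = (SUP \<delta> \<in> {0<..}. hausdorff_premeasure s \<delta> A)"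

definition hausdorff_dim :: "'a::metric_space set \<Rightarrow> ennreal" where
  "hausdorff_dim A = Inf {ennreal s | s. 0 \<le> s \<and> hausdorff_measure s A = 0}"

definition dot_image :: "'a::real_inner \<Rightarrow> 'a set \<Rightarrow> real set" where
  "dot_image a A = {a \<bullet> y | y. y \<in> A}"

end

theory Submission
  imports Defs "HOL-Probability.Characteristic_Functions" "HOL-Real_Asymp.Real_Asymp"
begin

text \<open>
  Let \<open>(n + 1)/2 < s < dim A\<close>.  Capacitability of analytic sets gives a compact \<open>K \<subseteq> A\<close> all of
  whose neighbourhoods have dyadic \<open>s\<close>-content bounded below, so at every scale \<open>d\<close> there is a finitely
  supported measure \<open>w\<close> on \<open>K\<close>, of total mass bounded below, with \<open>w (B(x, r)) \<le> C r\<^sup>s\<close> for \<open>r \<ge> d\<close>.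

  On the Fourier side the \<open>L\<^sup>2\<close> energies of the projections \<open>y \<mapsto> a \<bullet> y\<close> of \<open>w\<close>, averaged over \<open>a\<close>
  with respect to \<open>w\<close> itself, are an integral of the squared Fourier transform of \<open>w\<close> over the lines
  \<open>t a\<close>, mollified at unit scale because \<open>w\<close> has bounded support.  The Frostman bound for the
  \<open>a\<close>-average at scale \<open>1/t\<close> gains \<open>t\<^sup>-\<^sup>s\<close>, the Frostman bound for the remaining energy gains another
  \<open>t\<^sup>-\<^sup>s\<close>, and the unit-scale mollification costs \<open>t\<^sup>n\<close>; as \<open>2 s - n > 1\<close> the integral over \<open>t\<close>
  converges.  Hence for every \<open>d\<close> some \<open>a\<close> in \<open>K\<close> has a projection whose \<open>d\<close>-neighbourhood has measure
  bounded below, uniformly in \<open>d\<close>, and a limit point of these \<open>a\<close> as \<open>d \<rightarrow> 0\<close> is as required.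
\<close>

section \<open>Analytic sets and capacitability\<close>

text \<open>The Suslin form: \<open>nat \<Rightarrow> nat\<close> carries the product of discrete
  topologies, so it is Baire space. The second component is a witness sequence; bounding all its
  coordinates leaves a compact set.\<close>

definition analytic :: "'a::topological_space set \<Rightarrow> bool" where
  "analytic A \<longleftrightarrow> (\<exists>C :: ('a \<times> (nat \<Rightarrow> nat)) set. closed C \<and> A = fst ` C)"

lemma analytic_closed: "closed A \<Longrightarrow> analytic A"
  unfolding analytic_def
  by (intro exI[of _ "A \<times> UNIV"]) (auto intro: closed_Times)

text \<open>The first term of the new witness names the index of a set containing the point, and the
  shifted tail is a witness for that set.\<close>

lemma analytic_UN:
  fixes A :: "nat \<Rightarrow> 'a::topological_space set"
  assumes "\<And>n. analytic (A n)"
  shows "analytic (\<Union>n. A n)"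
proof -
  obtain C :: "nat \<Rightarrow> ('a \<times> (nat \<Rightarrow> nat)) set" where C: "\<And>n. closed (C n)" "\<And>n. A n = fst ` C n"
    using assms unfolding analytic_def by metis
  \<comment> \<open>The union inside the intersection is an implication, "if the first term is
    \<open>n\<close>, then the tail is in \<open>C n\<close>"; it is closed because the first
    alternative is clopen.\<close>
  define D where "D = (\<Inter>n. {p :: 'a \<times> (nat \<Rightarrow> nat). snd p 0 \<noteq> n} \<union> (\<lambda>p. (fst p, \<lambda>i. snd p (Suc i))) -` C n)"
  have sh: "continuous_on UNIV (\<lambda>p :: 'a \<times> (nat \<Rightarrow> nat). (fst p, \<lambda>i. snd p (Suc i)))"
    by (intro continuous_on_Pair continuous_on_fst continuous_on_coordinatewise_then_product
        continuous_on_product_then_coordinatewise[OF continuous_on_snd] continuous_on_id)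
  have c0: "continuous_on UNIV (\<lambda>p :: 'a \<times> (nat \<Rightarrow> nat). snd p 0)"
    by (intro continuous_on_product_then_coordinatewise[OF continuous_on_snd] continuous_on_id)
  have "closed {p :: 'a \<times> (nat \<Rightarrow> nat). snd p 0 \<noteq> n}" for n
  proof -
    have "closed ((\<lambda>p :: 'a \<times> (nat \<Rightarrow> nat). snd p 0) -` (-{n}))"
      unfolding closed_def vimage_Compl[symmetric] double_complement
      by (rule open_vimage[OF _ c0]) (rule discrete_topology_class.open_discrete)
    then show ?thesis by (simp add: vimage_def)
  qed
  then have "closed D"
    unfolding D_def using C(1) closed_vimage[OF _ sh] by (intro closed_INT ballI closed_Un) auto
  moreover have "(\<Union>n. A n) = fst ` D"
  proof (intro equalityI subsetI)
    fix x assume "x \<in> (\<Union>n. A n)"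
    then obtain n \<sigma> where "(x, \<sigma>) \<in> C n" using C(2) by auto
    then have "(x, case_nat n \<sigma>) \<in> D" by (auto simp: D_def)
    then show "x \<in> fst ` D" by force
  next
    fix x assume "x \<in> fst ` D"
    then obtain \<sigma> where "(x, \<sigma>) \<in> D" by auto
    then have "(x, \<lambda>i. \<sigma> (Suc i)) \<in> C (\<sigma> 0)" by (auto simp: D_def)
    then show "x \<in> (\<Union>n. A n)" using C(2) by force
  qed
  ultimately show ?thesis unfolding analytic_def by blast
qed

text \<open>One sequence stores countably many witnesses, the \<open>n\<close>-th along the indices
  \<open>prod_encode (n, i)\<close>.\<close>

lemma analytic_INT:
  fixes A :: "nat \<Rightarrow> 'a::topological_space set"
  assumes "\<And>n. analytic (A n)"
  shows "analytic (\<Inter>n. A n)"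
proof -
  obtain C :: "nat \<Rightarrow> ('a \<times> (nat \<Rightarrow> nat)) set" where C: "\<And>n. closed (C n)" "\<And>n. A n = fst ` C n"
    using assms unfolding analytic_def by metis
  define D where "D = (\<Inter>n. (\<lambda>p :: 'a \<times> (nat \<Rightarrow> nat). (fst p, \<lambda>i. snd p (prod_encode (n, i)))) -` C n)"
  have sh: "continuous_on UNIV (\<lambda>p :: 'a \<times> (nat \<Rightarrow> nat). (fst p, \<lambda>i. snd p (prod_encode (n, i))))" for n
    by (intro continuous_on_Pair continuous_on_fst continuous_on_coordinatewise_then_product
        continuous_on_product_then_coordinatewise[OF continuous_on_snd] continuous_on_id)
  have "closed D"
    unfolding D_def using C(1) closed_vimage[OF _ sh] by (intro closed_INT ballI) auto
  moreover have "(\<Inter>n. A n) = fst ` D"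
  proof (intro equalityI subsetI)
    fix x assume "x \<in> (\<Inter>n. A n)"
    then have "\<forall>n. \<exists>\<sigma>. (x, \<sigma>) \<in> C n" using C(2) by force
    then obtain \<sigma> where "\<And>n. (x, \<sigma> n) \<in> C n" by metis
    then have "(x, \<lambda>j. case prod_decode j of (n, i) \<Rightarrow> \<sigma> n i) \<in> D" by (auto simp: D_def)
    then show "x \<in> fst ` D" by force
  next
    fix x assume "x \<in> fst ` D"
    then obtain \<sigma> where "(x, \<sigma>) \<in> D" by auto
    then have "(x, \<lambda>i. \<sigma> (prod_encode (n, i))) \<in> C n" for n by (auto simp: D_def)
    then show "x \<in> (\<Inter>n. A n)" using C(2) by force
  qed
  ultimately show ?thesis unfolding analytic_def by blast
qed

lemma analytic_open:
  fixes A :: "'a::euclidean_space set"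
  assumes "open A" shows "analytic A"
proof -
  obtain C :: "nat \<Rightarrow> 'a set" where "\<And>n. compact (C n)" "A = (\<Union>n. C n)"
    using open_Union_compact_subsets[OF assms] by metis
  then show ?thesis using analytic_UN[of C] by (simp add: analytic_closed compact_imp_closed)
qed

text \<open>Complements of analytic sets need not be analytic, so the induction over the
  sigma-algebra carries each set together with its complement.\<close>

lemma analytic_borel:
  fixes A :: "'a::euclidean_space set"
  assumes "A \<in> sets borel" shows "analytic A"
proof -
  have "A \<in> sigma_sets UNIV {S. open S}"
    using assms by (simp add: sets_borel)
  then have "analytic A \<and> analytic (- A)"
  proof (induction rule: sigma_sets.induct)
    case (Basic a)
    then show ?case by (simp add: analytic_open analytic_closed closed_Compl)
  next
    case Empty
    then show ?case by (simp add: analytic_open)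
  next
    case (Compl a)
    then show ?case by (simp add: Compl_eq_Diff_UNIV[symmetric])
  next
    case (Union a)
    then show ?case by (simp add: analytic_UN analytic_INT Compl_UN)
  qed
  then show ?thesis ..
qed

section \<open>Choquet's capacitability theorem\<close>

lemma compact_bounded_sequences:
  fixes N :: "nat \<Rightarrow> nat"
  shows "compact {\<sigma> :: nat \<Rightarrow> nat. \<forall>i. \<sigma> i \<le> N i}"
proof -
  have "compactin (product_topology (\<lambda>i. euclidean) UNIV) (PiE UNIV (\<lambda>i. {..N i}))"
    unfolding compactin_PiE by (simp add: finite_imp_compact)
  then have "compact (PiE UNIV (\<lambda>i. {..N i}))"
    by (simp add: euclidean_product_topology)
  moreover have "PiE UNIV (\<lambda>i. {..N i}) = {\<sigma> :: nat \<Rightarrow> nat. \<forall>i. \<sigma> i \<le> N i}" by (auto simp: PiE_def)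
  ultimately show ?thesis by simp
qed

text \<open>Continuity along increasing sequences allows the witness coordinates to be bounded one
  after the other while \<open>c\<close> stays above \<open>l\<close>. The points with a fully
  bounded witness form the compact set \<open>K\<close>. Continuity along decreasing compact sets is
  not assumed, so the lower bound is stated for open neighbourhoods of \<open>K\<close>.\<close>

theorem capacitability:
  fixes c :: "'a::metric_space set \<Rightarrow> 'b::linorder"
  assumes mono: "\<And>E F. E \<subseteq> F \<Longrightarrow> c E \<le> c F"
    and inc: "\<And>E l. incseq E \<Longrightarrow> l < c (\<Union>i::nat. E i) \<Longrightarrow> \<exists>i. l < c (E i)"
    and A: "analytic A" "compact B" "A \<subseteq> B" and l: "l < c A"
  obtains K where "compact K" "K \<subseteq> A" "\<And>V. open V \<Longrightarrow> K \<subseteq> V \<Longrightarrow> l < c V"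
proof -
  obtain C :: "('a \<times> (nat \<Rightarrow> nat)) set" where C: "closed C" "A = fst ` C"
    using A unfolding analytic_def by metis
  \<comment> \<open>The points of \<open>A\<close> with a witness whose first \<open>k\<close>
    coordinates are bounded by \<open>N\<close>; the later coordinates are still free.\<close>
  define S where "S N k = fst ` {(x, \<sigma>) \<in> C. \<forall>i<k. \<sigma> i \<le> N i}" for N :: "nat \<Rightarrow> nat" and k
  have Scong: "S N k = S N' k" if "\<And>i. i < k \<Longrightarrow> N i = N' i" for N N' k
    unfolding S_def using that by auto
  have step: "\<exists>m. l < c (S (N(k := m)) (Suc k))" if "l < c (S N k)" for N k
  proof -
    have "S N k = (\<Union>m. S (N(k := m)) (Suc k))"
    proof (intro equalityI subsetI)
      fix x assume "x \<in> S N k"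
      then obtain \<sigma> where "(x, \<sigma>) \<in> C" "\<forall>i<k. \<sigma> i \<le> N i" unfolding S_def by auto
      then have "x \<in> S (N(k := \<sigma> k)) (Suc k)" unfolding S_def by (force simp: less_Suc_eq)
      then show "x \<in> (\<Union>m. S (N(k := m)) (Suc k))" by blast
    qed (force simp: S_def less_Suc_eq)
    moreover have "incseq (\<lambda>m. S (N(k := m)) (Suc k))"
      unfolding incseq_def S_def by (auto intro!: image_mono simp: less_Suc_eq)
    ultimately show ?thesis using inc[of "\<lambda>m. S (N(k := m)) (Suc k)" l] that by simp
  qed
  have "\<exists>F :: nat \<Rightarrow> nat \<Rightarrow> nat. \<forall>k. l < c (S (F k) k) \<and> (\<exists>m. F (Suc k) = (F k)(k := m))"
  proof (rule dependent_nat_choice)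
    show "\<exists>N. l < c (S N 0)" using l by (simp add: S_def C case_prod_unfold)
  qed (use step in blast)
  then obtain F :: "nat \<Rightarrow> nat \<Rightarrow> nat" where F: "\<And>k. l < c (S (F k) k)"
    "\<And>k. \<exists>m. F (Suc k) = (F k)(k := m)" by metis
  \<comment> \<open>\<open>F (Suc k)\<close> alters \<open>F k\<close> at \<open>k\<close> only, so
    coordinate \<open>i\<close> has its final value from \<open>F (Suc i)\<close> on.\<close>
  define N where "N i = F (Suc i) i" for i
  have FN: "F k i = N i" if "i < k" for i k
    using that
  proof (induction k)
    case (Suc k)
    obtain m where "F (Suc k) = (F k)(k := m)" using F(2) by blast
    then show ?case using Suc by (cases "i = k") (auto simp: N_def)
  qed simp
  have Sl: "l < c (S N k)" for k
    using F(1)[of k] Scong[of k "F k" N] FN by simp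
  define K where "K = fst ` (C \<inter> (B \<times> {\<sigma>. \<forall>i. \<sigma> i \<le> N i}))"
  have "compact (C \<inter> (B \<times> {\<sigma>. \<forall>i. \<sigma> i \<le> N i}))"
    using C A by (intro closed_Int_compact compact_Times compact_bounded_sequences)
  then have cK: "compact K"
    unfolding K_def by (intro compact_continuous_image continuous_on_fst continuous_on_id)
  show ?thesis
  proof (rule that[OF cK])
    show "K \<subseteq> A" unfolding K_def C by auto
    fix V assume V: "open V" "K \<subseteq> V"
    \<comment> \<open>The sets \<open>S N k\<close> need not be compact. Points of them outside
      \<open>V\<close> nevertheless have a subsequence converging together with their witnesses, and
      the limit lies in \<open>K\<close> but not in \<open>V\<close>.\<close>
    have "\<exists>k. S N k \<subseteq> V"
    proof (rule ccontr)
      assume neg: "\<not> ?thesis"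
      have "\<forall>k. \<exists>x \<sigma>. (x, \<sigma>) \<in> C \<and> (\<forall>i<k. \<sigma> i \<le> N i) \<and> x \<notin> V"
      proof
        fix k
        from neg obtain x where "x \<in> S N k" "x \<notin> V" by blast
        then obtain \<sigma> where "(x, \<sigma>) \<in> C" "\<forall>i<k. \<sigma> i \<le> N i" unfolding S_def by auto
        then show "\<exists>x \<sigma>. (x, \<sigma>) \<in> C \<and> (\<forall>i<k. \<sigma> i \<le> N i) \<and> x \<notin> V"
          using \<open>x \<notin> V\<close> by blast
      qed
      then obtain x \<sigma> where x: "\<And>k. (x k, \<sigma> k) \<in> C" "\<And>k i. i < k \<Longrightarrow> \<sigma> k i \<le> N i" "\<And>k. x k \<notin> V"
        by metis
      \<comment> \<open>\<open>N i\<close> bounds \<open>\<sigma> k i\<close> only for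
        \<open>i < k\<close>; the finitely many \<open>k \<le> i\<close> are absorbed into a larger
        bound, which puts all the witnesses in one compact box.\<close>
      define N' where "N' i = Max (insert (N i) ((\<lambda>k. \<sigma> k i) ` {..i}))" for i
      have "\<sigma> k i \<le> N' i" for k i
      proof (cases "i < k")
        case True
        then have "\<sigma> k i \<le> N i" by (rule x)
        also have "\<dots> \<le> N' i" unfolding N'_def by (intro Max_ge) auto
        finally show ?thesis .
      next
        case False
        then show ?thesis unfolding N'_def by (intro Max_ge) auto
      qed
      then have inC: "\<forall>k. (x k, \<sigma> k) \<in> C \<inter> (B \<times> {\<sigma>. \<forall>i. \<sigma> i \<le> N' i})"
        using x(1) A(3) C(2) by force
      have "compact (C \<inter> (B \<times> {\<sigma>. \<forall>i. \<sigma> i \<le> N' i}))"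
        using C A by (intro closed_Int_compact compact_Times compact_bounded_sequences)
      then have "seq_compact (C \<inter> (B \<times> {\<sigma>. \<forall>i. \<sigma> i \<le> N' i}))"
        by (rule compact_imp_seq_compact)
      from seq_compactE[OF this inC] obtain p r where p: "p \<in> C \<inter> (B \<times> {\<sigma>. \<forall>i. \<sigma> i \<le> N' i})" "strict_mono r"
          "((\<lambda>k. (x k, \<sigma> k)) \<circ> r) \<longlonglongrightarrow> p"
        by blast
      obtain y \<tau> where y: "p = (y, \<tau>)" by (cases p)
      have lim: "(\<lambda>k. x (r k)) \<longlonglongrightarrow> y" "(\<lambda>k. \<sigma> (r k)) \<longlonglongrightarrow> \<tau>"
        using tendsto_fst[OF p(3)] tendsto_snd[OF p(3)] by (simp_all add: y o_def)
      \<comment> \<open>Convergence in a discrete factor means being eventually constant, so the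
        limit obeys the original bound \<open>N\<close> and not only \<open>N'\<close>.\<close>
      have "\<tau> i \<le> N i" for i
      proof -
        have "continuous_on UNIV (\<lambda>\<sigma> :: nat \<Rightarrow> nat. \<sigma> i)"
          by (rule continuous_on_product_coordinates)
        then have "(\<lambda>k. \<sigma> (r k) i) \<longlonglongrightarrow> \<tau> i"
          using lim(2) by (rule continuous_on_tendsto_compose) auto
        then have "\<forall>\<^sub>F k in sequentially. \<sigma> (r k) i = \<tau> i"
          by (simp add: tendsto_discrete)
        moreover have "\<forall>\<^sub>F k in sequentially. i < k" by (rule eventually_gt_at_top)
        ultimately have "\<forall>\<^sub>F k in sequentially. \<tau> i \<le> N i"
        proof eventually_elim
          case (elim k)
          have "i < r k" using elim(2) seq_suble[OF p(2), of k] by linarith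
          then show ?case using x(2)[of i "r k"] elim by simp
        qed
        then show ?thesis by simp
      qed
      then have "y \<in> K" unfolding K_def using p(1) y by force
      then have "y \<in> V" using V by auto
      then have "\<forall>\<^sub>F k in sequentially. x (r k) \<in> V"
        using lim(1) V(1) by (simp add: topological_tendstoD)
      then show False using x(3) by simp
    qed
    then obtain k where "S N k \<subseteq> V" ..
    then show "l < c V" using Sl[of k] mono[of "S N k" V] by (metis order_less_le_trans)
  qed
qed

section \<open>Measurability of projections\<close>

lemma dot_image_eq: "dot_image a A = (\<lambda>y. a \<bullet> y) ` A"
  unfolding dot_image_def by auto

lemma compact_dot_image: "compact K \<Longrightarrow> compact (dot_image a K)"
  unfolding dot_image_eq by (intro compact_continuous_image continuous_intros)

lemma dot_image_UN: "dot_image a (\<Union>i\<in>I. A i) = (\<Union>i\<in>I. dot_image a (A i))"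
  unfolding dot_image_eq by blast

text \<open>The outer measure of the projection is monotone and continuous along increasing unions
  of arbitrary sets, so capacitability applies to it. Outer regularity then turns the bound on
  neighbourhoods of \<open>K\<close> into one on \<open>K\<close> itself.\<close>

lemma compact_inner_regular_dot_image:
  fixes A :: "'a::euclidean_space set"
  assumes A: "A \<in> sets borel" "bounded A" and l: "l < outer_measure_of lborel (dot_image a A)"
  obtains K where "compact K" "K \<subseteq> A" "l \<le> emeasure lborel (dot_image a K)"
proof -
  obtain e where e: "A \<subseteq> cball 0 e" using bounded_subset_ballD[OF A(2), of 0] ball_subset_cball by blast
  obtain K where K: "compact K" "K \<subseteq> A"
    "\<And>V. open V \<Longrightarrow> K \<subseteq> V \<Longrightarrow> l < outer_measure_of lborel (dot_image a V)"
  proof (rule capacitability[of "\<lambda>E. outer_measure_of lborel (dot_image a E)" A "cball 0 e" l])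
    fix E F :: "'a set" assume "E \<subseteq> F"
    then show "outer_measure_of lborel (dot_image a E) \<le> outer_measure_of lborel (dot_image a F)"
      by (intro outer_measure_of_mono) (auto simp: dot_image_eq)
  next
    fix E :: "nat \<Rightarrow> 'a set" and l
    assume E: "incseq E" "l < outer_measure_of lborel (dot_image a (\<Union>i. E i))"
    have "incseq (\<lambda>i. dot_image a (E i))"
      using E(1) unfolding incseq_def dot_image_eq by (auto intro: image_mono)
    from SUP_outer_measure_of_incseq[OF _ this, of lborel]
    have "(SUP i. outer_measure_of lborel (dot_image a (E i))) = outer_measure_of lborel (dot_image a (\<Union>i. E i))"
      by (simp add: dot_image_UN)
    then show "\<exists>i. l < outer_measure_of lborel (dot_image a (E i))"
      using E(2) by (metis less_SUP_iff)
  qed (use e l analytic_borel[OF A(1)] in auto)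
  have cK: "compact (dot_image a K)" by (rule compact_dot_image[OF K(1)])
  have "l \<le> emeasure lborel (dot_image a K)"
  proof (rule ccontr)
    assume "\<not> ?thesis"
    then have Kl: "emeasure lborel (dot_image a K) < l" by simp
    have Kb: "dot_image a K \<in> sets borel" using cK by (intro borel_closed compact_imp_closed)
    obtain U where U: "open U" "dot_image a K \<subseteq> U" "emeasure lborel U < l"
    proof -
      obtain e where e: "0 < e" "emeasure lborel (dot_image a K) + ennreal e \<le> l"
      proof -
        have pos: "0 < l - emeasure lborel (dot_image a K)" using Kl by (simp add: diff_gr0_ennreal)
        obtain e where "0 < e" "ennreal e \<le> l - emeasure lborel (dot_image a K)"
        proof (cases "l - emeasure lborel (dot_image a K)")
          case (real r)
          then show ?thesis using pos by (intro that[of r]) auto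
        next
          case top
          then show ?thesis by (intro that[of 1]) auto
        qed
        then have "emeasure lborel (dot_image a K) + ennreal e
            \<le> emeasure lborel (dot_image a K) + (l - emeasure lborel (dot_image a K))"
          by (intro add_left_mono)
        also have "\<dots> = l" using Kl by (intro add_diff_inverse_ennreal) simp
        finally show ?thesis using that \<open>0 < e\<close> by blast
      qed
      obtain U where U: "open U" "dot_image a K \<subseteq> U" "emeasure lborel (U - dot_image a K) < e"
        using outer_regular_lborel[OF Kb e(1)] .
      have "emeasure lborel U \<le> emeasure lborel (dot_image a K) + emeasure lborel (U - dot_image a K)"
        using U Kb by (subst plus_emeasure) (auto intro!: emeasure_mono)
      also have "\<dots> < emeasure lborel (dot_image a K) + ennreal e"
        using U Kl by (subst ennreal_add_left_cancel_less) auto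
      finally show ?thesis using that U e by (meson order_less_le_trans)
    qed
    \<comment> \<open>The preimage of \<open>U\<close> is a neighbourhood of \<open>K\<close> whose
      projection stays in \<open>U\<close>, which is too small.\<close>
    have "open ((\<lambda>y. a \<bullet> y) -` U)" using U by (intro open_vimage continuous_intros)
    moreover have "K \<subseteq> (\<lambda>y. a \<bullet> y) -` U" using U by (auto simp: dot_image_eq)
    ultimately have "l < outer_measure_of lborel (dot_image a ((\<lambda>y. a \<bullet> y) -` U))" by (rule K(3))
    also have "\<dots> \<le> outer_measure_of lborel U"
      by (intro outer_measure_of_mono) (auto simp: dot_image_eq)
    also have "\<dots> = emeasure lborel U" using U by (intro outer_measure_of_eq) auto
    finally show False using U by simp
  qed
  then show ?thesis using that K by blast
qed

text \<open>The projection lies between a countable union \<open>U\<close> of compact projections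
  and a Borel hull \<open>B\<close> of the same measure. Boundedness makes that measure finite, so
  \<open>B - U\<close> is null.\<close>

lemma lebesgue_dot_image_bounded:
  fixes A :: "'a::euclidean_space set"
  assumes A: "A \<in> sets borel" "bounded A"
  shows "dot_image a A \<in> sets lebesgue"
proof -
  let ?m = "outer_measure_of lborel (dot_image a A)"
  obtain B where B: "B \<in> sets lborel" "dot_image a A \<subseteq> B" "?m = emeasure lborel B"
    using outer_measure_of_attain[of "dot_image a A" lborel] by auto
  have fin: "?m < \<infinity>"
  proof -
    have "bounded (dot_image a A)"
      unfolding dot_image_eq by (rule bounded_linear_image[OF A(2) bounded_linear_inner_right])
    from bounded_subset_ballD[OF this, of 0] obtain e where "dot_image a A \<subseteq> ball 0 e" by blast
    also have "\<dots> \<subseteq> cball 0 e" by (rule ball_subset_cball)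
    finally have "?m \<le> outer_measure_of lborel (cball (0::real) e)" by (rule outer_measure_of_mono)
    also have "\<dots> < \<infinity>" using emeasure_bounded_finite[OF bounded_cball[of "0::real" e]] by simp
    finally show ?thesis .
  qed
  have "\<exists>K. compact K \<and> K \<subseteq> A \<and> ?m \<le> emeasure lborel (dot_image a K) + ennreal (1 / Suc n)" for n
  proof (cases "?m = 0")
    case False
    then have "?m - ennreal (1 / Suc n) < ?m"
      using fin by (intro ennreal_between) (auto simp: zero_less_iff_neq_zero)
    from compact_inner_regular_dot_image[OF A this] show ?thesis
      by (auto simp: ennreal_minus_le_iff add.commute)
  qed (auto intro!: exI[of _ "{}"])
  then obtain K where K: "\<And>n. compact (K n)" "\<And>n. K n \<subseteq> A"
      "\<And>n. ?m \<le> emeasure lborel (dot_image a (K n)) + ennreal (1 / Suc n)" by metis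
  define U where "U = (\<Union>n. dot_image a (K n))"
  have Kb: "dot_image a (K n) \<in> sets borel" for n
    by (intro borel_closed compact_imp_closed compact_dot_image K)
  have Ub: "U \<in> sets lborel" unfolding U_def using Kb by simp
  have UA: "U \<subseteq> dot_image a A" unfolding U_def dot_image_eq using K(2) by blast
  have "emeasure lborel B \<le> emeasure lborel U"
  proof (rule ennreal_le_epsilon)
    fix e :: real assume "0 < e"
    then obtain n where n: "1 / Suc n < e" using nat_approx_posE by metis
    have "emeasure lborel B \<le> emeasure lborel (dot_image a (K n)) + ennreal (1 / Suc n)"
      using K(3)[of n] B by simp
    also have "\<dots> \<le> emeasure lborel U + ennreal e"
      using n Ub unfolding U_def by (intro add_mono emeasure_mono ennreal_leI) auto
    finally show "emeasure lborel B \<le> emeasure lborel U + ennreal e" .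
  qed
  then have "emeasure lborel (B - U) = 0"
    using B Ub UA fin emeasure_mono[of U B lborel]
    by (subst emeasure_Diff) (auto simp: less_top)
  then have "B - U \<in> null_sets lborel" using B Ub by (auto simp: null_sets_def)
  then have "dot_image a A - U \<in> null_sets lebesgue"
    by (intro null_sets_completion_subset[OF _ null_sets_completionI, of _ "B - U"]) (use B in auto)
  moreover have "dot_image a A = U \<union> (dot_image a A - U)" using UA by auto
  moreover have "U \<in> sets lebesgue" using Ub by simp
  ultimately show ?thesis by (metis null_setsD2 sets.Un)
qed

text \<open>
  Needed because \<open>emeasure\<close> is \<open>0\<close> on non-measurable sets: the projection of a Borel set is analytic, but
  in general not Borel.
\<close>

lemma lebesgue_dot_image:
  fixes A :: "'a::euclidean_space set"
  assumes A: "A \<in> sets borel"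
  shows "dot_image a A \<in> sets lebesgue"
proof -
  have "dot_image a A = (\<Union>n. dot_image a (A \<inter> cball 0 (real n)))"
  proof -
    have "A = (\<Union>n. A \<inter> cball 0 (real n))" using real_arch_simple by (auto simp: dist_norm)
    then show ?thesis by (metis dot_image_UN)
  qed
  moreover have "dot_image a (A \<inter> cball 0 (real n)) \<in> sets lebesgue" for n
    using A by (intro lebesgue_dot_image_bounded) (auto intro: bounded_Int)
  ultimately show ?thesis by (simp only:) (intro sets.countable_UN image_subsetI)
qed

section \<open>Contents of nets\<close>

definition net_content :: "'a set measure \<Rightarrow> 'a set set \<Rightarrow> 'a set \<Rightarrow> ennreal" where
  "net_content \<nu> D E = (INF \<U> \<in> {\<U>. \<U> \<subseteq> D \<and> E \<subseteq> \<Union>\<U>}. emeasure \<nu> \<U>)"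

lemma net_content_le: "\<U> \<subseteq> D \<Longrightarrow> E \<subseteq> \<Union>\<U> \<Longrightarrow> net_content \<nu> D E \<le> emeasure \<nu> \<U>"
  unfolding net_content_def by (rule INF_lower) auto

lemma net_content_mono: "E \<subseteq> F \<Longrightarrow> net_content \<nu> D E \<le> net_content \<nu> D F"
  unfolding net_content_def by (rule INF_superset_mono) auto

lemma net_content_empty [simp]: "net_content \<nu> D {} = 0"
  using net_content_le[of "{}" D "{}" \<nu>] by simp

lemma net_content_approx:
  assumes "net_content \<nu> D E < \<infinity>" "0 < e"
  obtains \<U> where "\<U> \<subseteq> D" "E \<subseteq> \<Union>\<U>" "emeasure \<nu> \<U> < net_content \<nu> D E + e"
proof -
  have "net_content \<nu> D E + 0 < net_content \<nu> D E + e"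
    using assms by (subst ennreal_add_left_cancel_less) (auto simp: less_top)
  then show ?thesis
    unfolding net_content_def[of \<nu> D E] add_0_right INF_less_iff using that
    by (auto simp: net_content_def)
qed

lemma net_content_UN_le:
  fixes E :: "nat \<Rightarrow> 'a set"
  assumes "sets \<nu> = UNIV"
  shows "net_content \<nu> D (\<Union>i. E i) \<le> (\<Sum>i. net_content \<nu> D (E i))"
proof (cases "\<exists>i. net_content \<nu> D (E i) = \<infinity>")
  case True
  then obtain i where i: "net_content \<nu> D (E i) = \<infinity>" ..
  have "net_content \<nu> D (E i) \<le> (\<Sum>i. net_content \<nu> D (E i))"
    using sum_le_suminf[of "\<lambda>i. net_content \<nu> D (E i)" "{i}"] by (simp add: summableI)
  then show ?thesis using i by (simp add: top_unique)
next
  case False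
  show ?thesis
  proof (rule ennreal_le_epsilon)
    fix e :: real assume e: "0 < e"
    have "\<exists>\<U>. \<U> \<subseteq> D \<and> E i \<subseteq> \<Union>\<U> \<and> emeasure \<nu> \<U> < net_content \<nu> D (E i) + ennreal (e * (1/2)^Suc i)" for i
    proof -
      have "net_content \<nu> D (E i) < \<infinity>" "0 < ennreal (e * (1/2)^Suc i)"
        using False e by (auto simp: less_top)
      then show ?thesis by (rule net_content_approx) blast
    qed
    from choice[OF allI, OF this] obtain \<U> where "\<forall>i. \<U> i \<subseteq> D \<and> E i \<subseteq> \<Union>(\<U> i) \<and>
        emeasure \<nu> (\<U> i) < net_content \<nu> D (E i) + ennreal (e * (1/2)^Suc i)" ..
    then have U: "\<And>i. \<U> i \<subseteq> D" "\<And>i. E i \<subseteq> \<Union>(\<U> i)"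
        "\<And>i. emeasure \<nu> (\<U> i) < net_content \<nu> D (E i) + ennreal (e * (1/2)^Suc i)"
      by auto
    have "net_content \<nu> D (\<Union>i. E i) \<le> emeasure \<nu> (\<Union>i. \<U> i)"
    proof (rule net_content_le)
      show "(\<Union>i. \<U> i) \<subseteq> D" using U(1) by (rule UN_least)
      show "(\<Union>i. E i) \<subseteq> \<Union>(\<Union>i. \<U> i)" using U(2) by (intro UN_least) blast
    qed
    also have "\<dots> \<le> (\<Sum>i. emeasure \<nu> (\<U> i))"
      using assms by (intro emeasure_subadditive_countably) auto
    also have "\<dots> \<le> (\<Sum>i. net_content \<nu> D (E i) + ennreal (e * (1/2)^Suc i))"
      using U(3) by (intro suminf_le) (auto simp: less_imp_le)
    also have "\<dots> = (\<Sum>i. net_content \<nu> D (E i)) + (\<Sum>i. ennreal (e * (1/2)^Suc i))"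
      by (intro suminf_add[symmetric]) auto
    also have "(\<Sum>i. ennreal (e * (1/2)^Suc i)) = ennreal e"
      using e sums_mult[OF power_half_series, of e] by (intro suminf_ennreal_eq) auto
    finally show "net_content \<nu> D (\<Union>i. E i) \<le> (\<Sum>i. net_content \<nu> D (E i)) + ennreal e" .
  qed
qed

lemma net_content_Un_le:
  assumes "sets \<nu> = UNIV"
  shows "net_content \<nu> D (E \<union> F) \<le> net_content \<nu> D E + net_content \<nu> D F"
proof -
  let ?g = "\<lambda>i::nat. if i = 0 then E else if i = 1 then F else {}"
  have "(\<Union>i. ?g i) = E \<union> F"
    by (auto split: if_splits)
  moreover have "(\<Sum>i. net_content \<nu> D (?g i)) = (\<Sum>i\<in>{0,1}. net_content \<nu> D (?g i))"
    by (rule suminf_finite) auto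
  ultimately show ?thesis
    using net_content_UN_le[OF assms, of D ?g] by simp
qed

lemma net_content_finite_UN_le:
  assumes "sets \<nu> = UNIV" "finite I"
  shows "net_content \<nu> D (\<Union>i\<in>I. E i) \<le> (\<Sum>i\<in>I. net_content \<nu> D (E i))"
  using assms(2)
proof (induction I)
  case (insert i I)
  then show ?case
    using net_content_Un_le[OF assms(1), of D "E i" "\<Union>i\<in>I. E i"]
    by simp (meson add_left_mono order_trans)
qed simp

text \<open>
  The maximal members of the union of near-optimal covers of the \<open>E i\<close> cover the limit set; they are
  charged, generation by generation, to the members of the current cover that they contain.
\<close>

lemma net_content_incseq:
  fixes E :: "nat \<Rightarrow> 'a set"
  assumes \<nu>: "sets \<nu> = UNIV"
    and nested: "\<And>Q R. Q \<in> D \<Longrightarrow> R \<in> D \<Longrightarrow> Q \<inter> R = {} \<or> Q \<subseteq> R \<or> R \<subseteq> Q"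
    and fin: "\<And>Q. Q \<in> D \<Longrightarrow> finite {R\<in>D. Q \<subseteq> R}"
    and E: "incseq E"
  shows "net_content \<nu> D (\<Union>i. E i) \<le> (SUP i. net_content \<nu> D (E i))"
proof (cases "(SUP i. net_content \<nu> D (E i)) = \<infinity>")
  case False
  define L where "L = (SUP i. net_content \<nu> D (E i))"
  have Mle: "net_content \<nu> D (E i) \<le> L" for i unfolding L_def by (rule SUP_upper) auto
  have Mfin: "net_content \<nu> D (E i) < \<infinity>" for i
  proof -
    have "L < \<infinity>" using False unfolding L_def[symmetric] by (simp add: less_top)
    then show ?thesis by (rule order_le_less_trans[OF Mle])
  qed
  have "net_content \<nu> D (\<Union>i. E i) \<le> L"
  proof (rule ennreal_le_epsilon)
    fix e0 :: real assume "0 < e0"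
    define e where "e = e0 / 2"
    have e: "0 < e" using \<open>0 < e0\<close> by (simp add: e_def)
    \<comment> \<open>\<open>d i\<close> is the error allowed in the \<open>i\<close>-th cover, and
      \<open>d' i\<close> is the sum of the errors \<open>d j\<close> with
      \<open>j < i\<close>.\<close>
    define d where "d i = ennreal (e/2 * (1/2)^i)" for i :: nat
    define d' where "d' i = ennreal (e * (1 - (1/2)^i))" for i :: nat
    have d': "d' i + d i = d' (Suc i)" for i
      unfolding d_def d'_def using e
      by (subst ennreal_plus[symmetric]) (auto simp: algebra_simps power_le_one)
    have dpos: "0 < d i" for i using e by (simp add: d_def)
    have "\<exists>\<U>. \<U> \<subseteq> D \<and> E i \<subseteq> \<Union>\<U> \<and> emeasure \<nu> \<U> < net_content \<nu> D (E i) + d i" for i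
      using Mfin[of i] dpos[of i] by (rule net_content_approx) blast
    from choice[OF allI, OF this] obtain \<U> where "\<forall>i. \<U> i \<subseteq> D \<and> E i \<subseteq> \<Union>(\<U> i) \<and>
        emeasure \<nu> (\<U> i) < net_content \<nu> D (E i) + d i" ..
    then have U: "\<And>i. \<U> i \<subseteq> D" "\<And>i. E i \<subseteq> \<Union>(\<U> i)"
        "\<And>i. emeasure \<nu> (\<U> i) < net_content \<nu> D (E i) + d i"
      by auto
    have Ufin: "emeasure \<nu> (\<U> i) < \<infinity>" for i
    proof -
      have "net_content \<nu> D (E i) + d i < \<infinity>" using Mfin[of i] by (simp add: d_def less_top)
      then show ?thesis using U(3)[of i] by (rule order.strict_trans[rotated])
    qed
    define \<V> where "\<V> = (\<Union>i. \<U> i)"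
    \<comment> \<open>Maximality refers to the union of all covers; by \<open>fin\<close> every
      member lies in a maximal one.\<close>
    define \<G> where "\<G> = {Q\<in>\<V>. \<forall>R\<in>\<V>. Q \<subseteq> R \<longrightarrow> R = Q}"
    have VD: "\<V> \<subseteq> D" using U unfolding \<V>_def by auto
    have max: "\<exists>R\<in>\<G>. Q \<subseteq> R" if Q: "Q \<in> \<V>" for Q
    proof -
      let ?S = "{R\<in>\<V>. Q \<subseteq> R}"
      have "finite ?S" using Q VD by (intro finite_subset[OF _ fin[of Q]]) auto
      from finite_has_maximal2[OF this, of Q] Q obtain R where R: "R \<in> ?S" "Q \<subseteq> R"
        "\<forall>b\<in>?S. R \<subseteq> b \<longrightarrow> R = b" by blast
      have "S = R" if "S \<in> \<V>" "R \<subseteq> S" for S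
        using R that by auto
      then have "R \<in> \<G>" unfolding \<G>_def using R by auto
      then show ?thesis using R by auto
    qed
    \<comment> \<open>\<open>G k\<close> holds the maximal sets that have appeared by generation
      \<open>k\<close>. \<open>In k\<close> and \<open>Old k\<close> are the members of the current
      and of the next cover to which these sets are charged.\<close>
    define G where "G k = {Q\<in>\<G>. \<exists>i\<le>k. Q \<in> \<U> i}" for k
    define In where "In k = {Q\<in>\<U> k. \<exists>R\<in>G k. Q \<subseteq> R}" for k
    define Old where "Old k = {Q\<in>\<U> (Suc k). \<exists>R\<in>G k. Q \<subseteq> R}" for k
    have inG: "Q \<subseteq> R" if "Q \<in> \<V>" "R \<in> \<G>" "x \<in> Q" "x \<in> R" for Q R x
    proof -
      have "Q \<subseteq> R \<or> R \<subseteq> Q" using nested[of Q R] that VD unfolding \<G>_def by auto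
      then show ?thesis using that unfolding \<G>_def by auto
    qed
    have UV: "\<U> i \<subseteq> \<V>" for i unfolding \<V>_def by auto
    \<comment> \<open>The maximal sets found so far cost no more than the members of the current
      cover inside them, up to the accumulated errors.\<close>
    have claim: "emeasure \<nu> (G k) \<le> emeasure \<nu> (In k) + d' k" for k
    proof (induction k)
      case 0
      have "G 0 \<subseteq> In 0" unfolding G_def In_def by auto
      then show ?case using \<nu> by (simp add: d'_def emeasure_mono)
    next
      case (Suc k)
      let ?F = "E k \<inter> \<Union>(G k)"
      \<comment> \<open>A member of the next cover that meets a maximal set is contained in it, so
        \<open>Old k\<close> already covers \<open>?F\<close>.\<close>
      have "net_content \<nu> D ?F \<le> emeasure \<nu> (Old k)"
      proof (rule net_content_le)
        show "Old k \<subseteq> D" using U unfolding Old_def by auto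
        show "?F \<subseteq> \<Union>(Old k)"
        proof
          fix x assume x: "x \<in> ?F"
          then obtain R where R: "R \<in> G k" "x \<in> R" by auto
          have "x \<in> E (Suc k)" using x incseq_SucD[OF E] by auto
          then obtain Q where Q: "Q \<in> \<U> (Suc k)" "x \<in> Q" using U(2)[of "Suc k"] by auto
          have "Q \<subseteq> R" using inG[of Q R x] Q R UV unfolding G_def by auto
          then show "x \<in> \<Union>(Old k)" using Q R unfolding Old_def by auto
        qed
      qed
      \<comment> \<open>The rest of \<open>\<U> k\<close> covers what \<open>E k\<close> has outside
        \<open>G k\<close>. As \<open>\<U> k\<close> is near-optimal, \<open>In k\<close> cannot be
        much dearer than an optimal cover of \<open>?F\<close>; the finite cost of the rest
        cancels.\<close>
      moreover have "emeasure \<nu> (In k) \<le> net_content \<nu> D ?F + d k"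
      proof -
        let ?O = "\<U> k - In k"
        have split: "emeasure \<nu> (\<U> k) = emeasure \<nu> (In k) + emeasure \<nu> ?O"
          using \<nu> by (subst plus_emeasure) (auto simp: In_def intro!: arg_cong[where f="emeasure \<nu>"])
        have "net_content \<nu> D (E k - \<Union>(G k)) \<le> emeasure \<nu> ?O"
        proof (rule net_content_le)
          show "?O \<subseteq> D" using U by auto
          show "E k - \<Union>(G k) \<subseteq> \<Union>?O" using U(2)[of k] unfolding In_def by blast
        qed
        moreover have "net_content \<nu> D (E k) \<le> net_content \<nu> D ?F + net_content \<nu> D (E k - \<Union>(G k))"
          using net_content_Un_le[OF \<nu>, of D ?F "E k - \<Union>(G k)"] by (simp add: Int_Diff_Un)
        ultimately have "net_content \<nu> D (E k) \<le> net_content \<nu> D ?F + emeasure \<nu> ?O"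
          by (meson add_left_mono order_trans)
        then have "emeasure \<nu> (In k) + emeasure \<nu> ?O \<le> net_content \<nu> D ?F + emeasure \<nu> ?O + d k"
          using U(3)[of k] unfolding split by (meson add_right_mono less_imp_le order_trans)
        moreover have "emeasure \<nu> ?O < \<infinity>"
          using Ufin[of k] unfolding split by (simp add: less_top)
        ultimately show ?thesis
          using ennreal_add_left_cancel_le[of "emeasure \<nu> ?O" "emeasure \<nu> (In k)" "net_content \<nu> D ?F + d k"]
          by (auto simp: ac_simps)
      qed
      ultimately have "emeasure \<nu> (In k) \<le> emeasure \<nu> (Old k) + d k"
        by (meson add_right_mono order_trans)
      then have Gk: "emeasure \<nu> (G k) \<le> emeasure \<nu> (Old k) + d' (Suc k)"
        using Suc.IH unfolding d'[symmetric]

        using add_right_mono[of "emeasure \<nu> (In k)" "emeasure \<nu> (Old k) + d k" "d' k"]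
          order_trans[of "emeasure \<nu> (G k)" "emeasure \<nu> (In k) + d' k" "emeasure \<nu> (Old k) + d k + d' k"]
        by (simp add: ac_simps)
      let ?N = "G (Suc k) - G k"
      \<comment> \<open>A maximal set contained in a member of \<open>G k\<close> equals that
        member, so it is not new.\<close>
      have "?N \<inter> Old k = {}" unfolding G_def Old_def \<G>_def by auto
      moreover have sub: "?N \<union> Old k \<subseteq> In (Suc k)"
      proof
        fix Q assume "Q \<in> ?N \<union> Old k"
        then show "Q \<in> In (Suc k)"
        proof
          assume "Q \<in> ?N" then show ?thesis unfolding G_def In_def using le_Suc_eq by auto
        next
          assume "Q \<in> Old k" then show ?thesis unfolding G_def In_def Old_def
            by (auto intro: le_SucI)
        qed
      qed
      ultimately have "emeasure \<nu> ?N + emeasure \<nu> (Old k) \<le> emeasure \<nu> (In (Suc k))"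
        using \<nu> by (subst plus_emeasure) (auto intro!: emeasure_mono)
      moreover have "emeasure \<nu> (G (Suc k)) = emeasure \<nu> (G k) + emeasure \<nu> ?N"
        using \<nu> by (subst plus_emeasure) (auto simp: G_def intro: le_SucI intro!: arg_cong[where f="emeasure \<nu>"])
      moreover have "emeasure \<nu> (G k) + emeasure \<nu> ?N \<le> (emeasure \<nu> ?N + emeasure \<nu> (Old k)) + d' (Suc k)"
        using add_right_mono[OF Gk, of "emeasure \<nu> ?N"] by (simp add: ac_simps)
      ultimately show ?case
        by (metis (no_types) add_right_mono order_trans)
    qed
    have Gle: "emeasure \<nu> (G k) \<le> L + ennreal (2 * e)" for k
    proof -
      have "emeasure \<nu> (G k) \<le> emeasure \<nu> (\<U> k) + d' k"
      proof (rule order_trans[OF claim[of k]])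
        show "emeasure \<nu> (In k) + d' k \<le> emeasure \<nu> (\<U> k) + d' k"
          using \<nu> by (intro add_right_mono emeasure_mono) (auto simp: In_def)
      qed
      also have "\<dots> \<le> (net_content \<nu> D (E k) + d k) + d' k"
        using U(3)[of k] by (intro add_right_mono) auto
      also have "\<dots> = net_content \<nu> D (E k) + d' (Suc k)"
        using d'[of k] by (simp add: ac_simps)
      also have "\<dots> \<le> L + ennreal (2 * e)"
      proof (intro add_mono Mle)
        have "1 - (1/2)^Suc k \<le> (2::real)" by (simp add: order_trans[of _ 0])
        then have "e * (1 - (1/2)^Suc k) \<le> e * 2" using e by (intro mult_left_mono) auto
        then show "d' (Suc k) \<le> ennreal (2 * e)" unfolding d'_def by (intro ennreal_leI) simp
      qed
      finally show ?thesis .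
    qed
    have UG: "\<G> = (\<Union>k. G k)" unfolding G_def \<G>_def \<V>_def by auto
    have "net_content \<nu> D (\<Union>i. E i) \<le> emeasure \<nu> \<G>"
    proof (rule net_content_le)
      show "\<G> \<subseteq> D" using VD unfolding \<G>_def by auto
      show "(\<Union>i. E i) \<subseteq> \<Union>\<G>"
      proof
        fix x assume "x \<in> (\<Union>i. E i)"
        then obtain i Q where "Q \<in> \<U> i" "x \<in> Q" using U(2) by blast
        then show "x \<in> \<Union>\<G>" using max[of Q] UV by blast
      qed
    qed
    also have "\<dots> = (SUP k. emeasure \<nu> (G k))"
      unfolding UG using \<nu> by (intro SUP_emeasure_incseq[symmetric])
        (auto simp: incseq_def G_def intro: order_trans)
    also have "\<dots> \<le> L + ennreal (2 * e)" by (intro SUP_least Gle)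
    finally show "net_content \<nu> D (\<Union>i. E i) \<le> L + ennreal e0" by (simp add: e_def)
  qed
  then show ?thesis unfolding L_def .
next
  case True
  then show ?thesis by (simp only: infinity_ennreal_def top_greatest)
qed

section \<open>Dyadic cells and discrete Frostman measures\<close>

text \<open>Each vertex passes its mass to its children in proportion to their \<open>\<mu>\<close>.
  The mass is at most \<open>\<mu>\<close> of the vertex, hence at most the total
  \<open>\<mu>\<close> of the children, so no child receives more than its own \<open>\<mu>\<close>.
  The generation is an argument of its own because vertices of all generations share one
  type.\<close>

lemma tree_flow:
  fixes par :: "'k \<Rightarrow> 'k" and \<mu> :: "nat \<Rightarrow> 'k \<Rightarrow> real"
  assumes nonneg: "\<And>k z. 0 \<le> \<mu> k z" and fin: "\<And>z. finite (par -` {z})"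
    and sub: "\<And>k z. \<mu> k z \<le> (\<Sum>z'\<in>par -` {z}. \<mu> (Suc k) z')"
  obtains wt where "\<And>k z. 0 \<le> wt k z" "\<And>k z. wt k z \<le> \<mu> k z" "wt 0 = \<mu> 0"
    "\<And>k i z. finite ((par ^^ i) -` {z}) \<and> (\<Sum>z'\<in>(par ^^ i) -` {z}. wt (k + i) z') = wt k z"
proof -
  define S where "S k z = (\<Sum>z'\<in>par -` {z}. \<mu> (Suc k) z')" for k z
  \<comment> \<open>If the children carry no mass, then neither does the parent, so that \<open>x / 0 = 0\<close> does no harm.\<close>
  define wt where "wt = rec_nat (\<mu> 0) (\<lambda>k f z. f (par z) * \<mu> (Suc k) z / S k (par z))"
  have wt0: "wt 0 = \<mu> 0" and wtS: "wt (Suc k) z = wt k (par z) * \<mu> (Suc k) z / S k (par z)" for k z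
    by (simp_all add: wt_def)
  have S0: "0 \<le> S k z" for k z unfolding S_def by (intro sum_nonneg nonneg)
  have n: "0 \<le> wt k z" for k z
    by (induction k arbitrary: z) (auto simp: wt0 wtS nonneg S0)
  have le: "wt k z \<le> \<mu> k z" for k z
  proof (induction k arbitrary: z)
    case (Suc k)
    have "wt k (par z) \<le> S k (par z)" using Suc[of "par z"] sub[of k "par z"] by (simp add: S_def)
    then have "wt k (par z) / S k (par z) \<le> 1" using S0[of k "par z"] by (auto simp: divide_le_eq_1)
    then have "wt k (par z) / S k (par z) * \<mu> (Suc k) z \<le> 1 * \<mu> (Suc k) z"
      by (intro mult_right_mono nonneg)
    then show ?case by (simp add: wtS)
  qed (simp add: wt0)
  have ch: "(\<Sum>z'\<in>par -` {z}. wt (Suc k) z') = wt k z" for k z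
  proof -
    have "(\<Sum>z'\<in>par -` {z}. wt (Suc k) z') = (\<Sum>z'\<in>par -` {z}. wt k z / S k z * \<mu> (Suc k) z')"
      by (intro sum.cong) (auto simp: wtS)
    also have "\<dots> = wt k z / S k z * S k z" by (simp only: sum_distrib_left[symmetric] S_def)
    also have "\<dots> = wt k z"
    proof (cases "S k z = 0")
      case True
      then have "\<mu> k z = 0" using sub[of k z] nonneg[of k z] by (simp add: S_def)
      then have "wt k z = 0" using le[of k z] n[of k z] by simp
      then show ?thesis by simp
    qed simp
    finally show ?thesis .
  qed
  have "finite ((par ^^ i) -` {z}) \<and> (\<Sum>z'\<in>(par ^^ i) -` {z}. wt (k + i) z') = wt k z" for k i z
  proof (induction i)
    case (Suc i)
    have eq: "(par ^^ Suc i) -` {z} = (\<Union>u\<in>(par ^^ i) -` {z}. par -` {u})"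
      by (auto simp: funpow_Suc_right simp del: funpow.simps)
    have "(\<Sum>z'\<in>(par ^^ Suc i) -` {z}. wt (k + Suc i) z') = (\<Sum>u\<in>(par ^^ i) -` {z}. \<Sum>z'\<in>par -` {u}. wt (Suc (k + i)) z')"
      unfolding eq using Suc by (subst sum.UNION_disjoint) (auto simp: fin)
    also have "\<dots> = wt k z" using Suc by (simp add: ch)
    finally show ?case unfolding eq using Suc fin by auto
  qed simp
  then show ?thesis using that n le wt0 by blast
qed

section \<open>Dyadic cells\<close>

definition cell_key :: "real \<Rightarrow> nat \<Rightarrow> real ^ 'n \<Rightarrow> 'n \<Rightarrow> int" where
  "cell_key \<sigma> k x = (\<lambda>i. \<lfloor>\<sigma> * 2 ^ k * x $ i\<rfloor>)"

text \<open>For positive \<open>\<sigma>\<close> these are half-open cubes of side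
  \<open>1 / (\<sigma> * 2 ^ k)\<close>; \<open>\<sigma>\<close> sets the size of the coarsest
  generation.\<close>

definition cell :: "real \<Rightarrow> nat \<Rightarrow> ('n \<Rightarrow> int) \<Rightarrow> (real ^ 'n) set" where
  "cell \<sigma> k z = {x. cell_key \<sigma> k x = z}"

text \<open>Integer \<open>div\<close> rounds downwards like the floor, so negative coordinates are
  treated correctly.\<close>

definition parent_key :: "('n \<Rightarrow> int) \<Rightarrow> 'n \<Rightarrow> int" where
  "parent_key z = (\<lambda>i. z i div 2)"

definition cells :: "real \<Rightarrow> (real ^ 'n) set set" where
  "cells \<sigma> = {cell \<sigma> k z | k z. True}"

lemma parent_cell_key: "parent_key (cell_key \<sigma> (Suc k) x) = cell_key \<sigma> k x"
proof
  fix i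
  have "\<sigma> * 2 ^ k * x $ i = (\<sigma> * 2 ^ Suc k * x $ i) / real_of_int 2" by simp
  then show "parent_key (cell_key \<sigma> (Suc k) x) i = cell_key \<sigma> k x i"
    unfolding parent_key_def cell_key_def by (simp only: floor_divide_real_eq_div zero_le_numeral)
qed

lemma funpow_parent_cell_key: "(parent_key ^^ i) (cell_key \<sigma> (k + i) x) = cell_key \<sigma> k x"
  by (induction i) (auto simp: funpow_Suc_right parent_cell_key simp del: funpow.simps)

lemma cell_key_eq_mono: "k \<le> j \<Longrightarrow> cell_key \<sigma> j x = cell_key \<sigma> j y \<Longrightarrow> cell_key \<sigma> k x = cell_key \<sigma> k y"
  by (metis funpow_parent_cell_key le_add_diff_inverse)

lemma cell_eq: "x \<in> cell \<sigma> k z \<Longrightarrow> cell \<sigma> k z = cell \<sigma> k (cell_key \<sigma> k x)"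
  by (simp add: cell_def)

lemma cell_subset: "k \<le> j \<Longrightarrow> x \<in> cell \<sigma> k z \<Longrightarrow> x \<in> cell \<sigma> j u \<Longrightarrow> cell \<sigma> j u \<subseteq> cell \<sigma> k z"
  unfolding cell_def using cell_key_eq_mono by fastforce

lemma cells_nested: "Q \<in> cells \<sigma> \<Longrightarrow> R \<in> cells \<sigma> \<Longrightarrow> Q \<inter> R = {} \<or> Q \<subseteq> R \<or> R \<subseteq> Q"
  unfolding cells_def using cell_subset by (smt (verit) disjoint_iff mem_Collect_eq nat_le_linear)

lemma cell_nonempty: "0 < \<sigma> \<Longrightarrow> cell \<sigma> k z \<noteq> {}"
proof -
  assume "0 < \<sigma>"
  then have "(\<chi> i. of_int (z i) / (\<sigma> * 2 ^ k)) \<in> cell \<sigma> k z"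
    by (simp add: cell_def cell_key_def)
  then show ?thesis by auto
qed

text \<open>A supercell of generation at most \<open>k\<close> is determined by its generation and a
  point of \<open>Q\<close>. A finer one would lie in \<open>Q\<close> by nesting, hence equal
  it.\<close>

lemma finite_supercells:
  assumes "0 < \<sigma>" "Q \<in> cells \<sigma>"
  shows "finite {R \<in> cells \<sigma>. Q \<subseteq> R}"
proof -
  obtain k z where Q: "Q = cell \<sigma> k z" using assms unfolding cells_def by auto
  obtain x where x: "x \<in> Q" using cell_nonempty[OF assms(1)] Q by blast
  have "{R \<in> cells \<sigma>. Q \<subseteq> R} \<subseteq> insert Q ((\<lambda>j. cell \<sigma> j (cell_key \<sigma> j x)) ` {..k})"
  proof
    fix R assume R: "R \<in> {R \<in> cells \<sigma>. Q \<subseteq> R}"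
    then obtain j u where u: "R = cell \<sigma> j u" unfolding cells_def by auto
    have xR: "x \<in> cell \<sigma> j u" using R x u by auto
    show "R \<in> insert Q ((\<lambda>j. cell \<sigma> j (cell_key \<sigma> j x)) ` {..k})"
    proof (cases "j \<le> k")
      case True
      then show ?thesis using cell_eq[OF xR] u by auto
    next
      case False
      then have "R \<subseteq> Q" using cell_subset[of k j x \<sigma> z u] xR x Q u by auto
      then show ?thesis using R by auto
    qed
  qed
  then show ?thesis by (rule finite_subset) auto
qed

lemma abs_diff_in_cell:
  assumes "0 < \<sigma>" "x \<in> cell \<sigma> k z" "y \<in> cell \<sigma> k z"
  shows "\<bar>x $ i - y $ i\<bar> \<le> 1 / (\<sigma> * 2 ^ k)"
proof -
  have "\<lfloor>\<sigma> * 2 ^ k * x $ i\<rfloor> = \<lfloor>\<sigma> * 2 ^ k * y $ i\<rfloor>"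
    using assms by (metis (mono_tags, lifting) cell_def cell_key_def mem_Collect_eq)
  then have "\<bar>\<sigma> * 2 ^ k * x $ i - \<sigma> * 2 ^ k * y $ i\<bar> \<le> 1" by linarith
  also have "\<sigma> * 2 ^ k * x $ i - \<sigma> * 2 ^ k * y $ i = (\<sigma> * 2 ^ k) * (x $ i - y $ i)"
    by (simp add: algebra_simps)
  also have "\<bar>\<dots>\<bar> = \<bar>x $ i - y $ i\<bar> * (\<sigma> * 2 ^ k)" using assms(1) by (simp add: abs_mult)
  finally show ?thesis using assms(1) by (subst pos_le_divide_eq) auto
qed

lemma cell_dist_le:
  fixes x y :: "real ^ 'n"
  assumes "0 < \<sigma>" "x \<in> cell \<sigma> k z" "y \<in> cell \<sigma> k z"
  shows "dist x y \<le> real CARD('n) / (\<sigma> * 2 ^ k)"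
proof -
  have "norm (x - y) \<le> (\<Sum>i\<in>UNIV. \<bar>(x - y) $ i\<bar>)" by (rule norm_le_l1_cart)
  also have "\<dots> \<le> (\<Sum>i\<in>(UNIV :: 'n set). 1 / (\<sigma> * 2 ^ k))"
    by (intro sum_mono) (use abs_diff_in_cell[OF assms] in simp)
  finally show ?thesis by (simp add: dist_norm)
qed

lemma bounded_cell: "0 < \<sigma> \<Longrightarrow> bounded (cell \<sigma> k z)"
  unfolding bounded_two_points using cell_dist_le by blast

lemma diameter_cell_le:
  "0 < \<sigma> \<Longrightarrow> diameter (cell \<sigma> k z :: (real ^ 'n) set) \<le> real CARD('n) / (\<sigma> * 2 ^ k)"
  by (rule diameter_le) (auto simp: dist_norm[symmetric] cell_dist_le cell_nonempty)

lemma borel_cell: "cell \<sigma> k z \<in> sets borel"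
proof -
  have "cell \<sigma> k z = (\<Inter>i. {x. \<lfloor>\<sigma> * 2 ^ k * x $ i\<rfloor> = z i})"
    by (auto simp: cell_def cell_key_def fun_eq_iff)
  moreover have "{x. \<lfloor>\<sigma> * 2 ^ k * x $ i\<rfloor> = z i} \<in> sets borel" for i
    by measurable
  ultimately show ?thesis by (simp only:) (intro sets.finite_INT, auto)
qed

lemma finite_parent_fiber: "finite (parent_key -` {z :: 'n::finite \<Rightarrow> int})"
proof (rule finite_subset)
  show "parent_key -` {z} \<subseteq> PiE UNIV (\<lambda>i. {2 * z i .. 2 * z i + 1})"
    by (auto simp: parent_key_def)
qed (intro finite_PiE; auto)

lemma cell_children: "cell \<sigma> k z = (\<Union>z'\<in>parent_key -` {z}. cell \<sigma> (Suc k) z')"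
  unfolding cell_def using parent_cell_key by force

section \<open>Dyadic content and a discrete Frostman lemma\<close>

abbreviation diam_measure :: "real \<Rightarrow> 'a::metric_space set measure" where
  "diam_measure s \<equiv> density (count_space UNIV) (diam_pow s)"

lemma emeasure_diam_measure_single [simp]: "emeasure (diam_measure s) {Q} = diam_pow s Q"
  by (subst emeasure_density) (simp_all add: nn_integral_count_space_indicator[symmetric] one_ennreal_def[symmetric])

text \<open>The premeasure wants covers indexed by all natural numbers: the family is enumerated and
  the remaining indices get the empty set, whose \<open>diam_pow\<close> is 0.\<close>

lemma hausdorff_premeasure_le_diam_measure:
  assumes "countable \<U>" "E \<subseteq> \<Union>\<U>" "\<And>Q. Q \<in> \<U> \<Longrightarrow> bounded Q \<and> diameter Q \<le> d" "0 < d"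
  shows "hausdorff_premeasure s d E \<le> emeasure (diam_measure s) \<U>"
proof -
  define N where "N = to_nat_on \<U> ` \<U>"
  define U where "U i = (if i \<in> N then from_nat_into \<U> i else {})" for i
  define V where "V i = (if i \<in> N then {from_nat_into \<U> i} else {})" for i
  have fn: "from_nat_into \<U> (to_nat_on \<U> Q) = Q" if "Q \<in> \<U>" for Q
    using assms(1) that by simp
  have inN: "\<exists>Q\<in>\<U>. i = to_nat_on \<U> Q \<and> from_nat_into \<U> i = Q" if "i \<in> N" for i
    using that fn unfolding N_def by auto
  have UV: "(\<Union>i. V i) = \<U>"
  proof (intro equalityI subsetI)
    fix Q assume "Q \<in> \<U>"
    then have "Q \<in> V (to_nat_on \<U> Q)" by (auto simp: V_def N_def fn)
    then show "Q \<in> (\<Union>i. V i)" by blast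
  qed (use inN in \<open>auto simp: V_def split: if_splits\<close>)
  have "hausdorff_premeasure s d E \<le> (\<Sum>i. diam_pow s (U i))"
    unfolding hausdorff_premeasure_def
  proof (rule INF_lower, safe)
    fix x assume "x \<in> E"
    then obtain Q where "Q \<in> \<U>" "x \<in> Q" using assms by auto
    then have "x \<in> U (to_nat_on \<U> Q)" by (auto simp: U_def N_def fn)
    then show "x \<in> (\<Union>i. U i)" by blast
  next
    fix i show "bounded (U i)" using inN[of i] assms by (auto simp: U_def)
    show "diameter (U i) \<le> d" using inN[of i] assms by (auto simp: U_def)
  qed
  also have "\<dots> = (\<Sum>i. emeasure (diam_measure s) (V i))"
    by (intro suminf_cong) (auto simp: U_def V_def diam_pow_def)
  also have "\<dots> = emeasure (diam_measure s) (\<Union>i. V i)"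
  proof (intro suminf_emeasure)
    show "disjoint_family V" unfolding disjoint_family_on_def V_def using inN
      by (auto split: if_splits) metis
  qed simp
  finally show ?thesis unfolding UV .
qed

abbreviation cell_content :: "real \<Rightarrow> real \<Rightarrow> (real ^ 'n) set \<Rightarrow> ennreal" where
  "cell_content \<sigma> s \<equiv> net_content (diam_measure s) (cells \<sigma>)"

lemma cell_content_cell_le:
  fixes E :: "(real ^ 'n) set"
  assumes \<sigma>: "0 < \<sigma>" and s: "0 < s" and E: "E \<subseteq> cell \<sigma> k z"
  shows "cell_content \<sigma> s E \<le> ennreal ((real CARD('n) / (\<sigma> * 2 ^ k)) powr s)"
proof -
  have "cell_content \<sigma> s E \<le> emeasure (diam_measure s) {cell \<sigma> k z}"
    using E by (intro net_content_le) (auto simp: cells_def)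
  also have "\<dots> = ennreal (diameter (cell \<sigma> k z) powr s)"
    using s cell_nonempty[OF \<sigma>] by (simp add: diam_pow_def)
  also have "\<dots> \<le> ennreal ((real CARD('n) / (\<sigma> * 2 ^ k)) powr s)"
    using s diameter_cell_le[OF \<sigma>] by (intro ennreal_leI powr_mono2 diameter_ge_0 bounded_cell \<sigma>) auto
  finally show ?thesis .
qed

lemma card_key_box: "card {u :: 'n::finite \<Rightarrow> int. \<forall>i. \<bar>u i - c i\<bar> \<le> 4} = 9 ^ CARD('n)"
  and finite_key_box: "finite {u :: 'n::finite \<Rightarrow> int. \<forall>i. \<bar>u i - c i\<bar> \<le> 4}"
proof -
  have eq: "{u :: 'n \<Rightarrow> int. \<forall>i. \<bar>u i - c i\<bar> \<le> 4} = PiE UNIV (\<lambda>i. {c i - 4 .. c i + 4})"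
    by (auto simp: PiE_def Pi_def abs_le_iff) (smt (verit))+
  show "card {u :: 'n::finite \<Rightarrow> int. \<forall>i. \<bar>u i - c i\<bar> \<le> 4} = 9 ^ CARD('n)"
    unfolding eq by (subst card_PiE) auto
  show "finite {u :: 'n::finite \<Rightarrow> int. \<forall>i. \<bar>u i - c i\<bar> \<le> 4}"
    unfolding eq by (intro finite_PiE) auto
qed

text \<open>The content of \<open>B\<close> in a cell is at most the content in the children
  together, so \<open>tree_flow\<close> spreads the content of \<open>B\<close> down to generation
  \<open>k\<close> with no cell exceeding its own content. One atom per surviving cell is placed at
  a point of \<open>K\<close> near a point of \<open>B\<close> in that cell.\<close>

lemma frostman_discrete:
  fixes B K :: "(real ^ 'n) set"
  assumes \<sigma>: "0 < \<sigma>" and s: "0 < s" and B: "B \<subseteq> cell \<sigma> 0 z0"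
    and K: "\<And>y. y \<in> B \<Longrightarrow> \<exists>x\<in>K. dist x y \<le> 1 / (\<sigma> * 2 ^ k)"
  obtains I :: "('n \<Rightarrow> int) set" and w p where
    "finite I" "\<And>z. z \<in> I \<Longrightarrow> 0 \<le> w z" "\<And>z. z \<in> I \<Longrightarrow> p z \<in> K"
    "sum w I = enn2real (cell_content \<sigma> s B)"
    "\<And>x r. 1 / (\<sigma> * 2 ^ k) \<le> r \<Longrightarrow>
        (\<Sum>z | z \<in> I \<and> norm (p z - x) \<le> r. w z) \<le> 9 ^ CARD('n) * real CARD('n) powr s * r powr s"
proof -
  define n where "n = real CARD('n)"
  have n1: "1 \<le> n" unfolding n_def by (simp add: Suc_leI)
  define L where "L j = 1 / (\<sigma> * 2 ^ j)" for j :: nat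
  have L0: "0 < L j" for j using \<sigma> by (simp add: L_def)
  have top: "cell_content \<sigma> s (B \<inter> cell \<sigma> j z) < top" for j z
    using cell_content_cell_le[OF \<sigma> s, of "B \<inter> cell \<sigma> j z" j z] by (simp add: order_le_less_trans)
  define \<mu> where "\<mu> j z = enn2real (cell_content \<sigma> s (B \<inter> cell \<sigma> j z))" for j z
  have \<mu>0: "0 \<le> \<mu> j z" for j z by (simp add: \<mu>_def)
  have \<mu>_le: "\<mu> j z \<le> n powr s * L j powr s" for j z
  proof -
    have "\<mu> j z \<le> (n / (\<sigma> * 2 ^ j)) powr s"
      unfolding \<mu>_def n_def using cell_content_cell_le[OF \<sigma> s, of "B \<inter> cell \<sigma> j z" j z]
      by (intro enn2real_leI) auto
    also have "n / (\<sigma> * 2 ^ j) = n * L j" by (simp add: L_def)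
    finally show ?thesis using n1 L0[of j] by (simp add: powr_mult)
  qed
  have sub: "\<mu> j z \<le> (\<Sum>z'\<in>parent_key -` {z}. \<mu> (Suc j) z')" for j z
  proof -
    have "cell_content \<sigma> s (B \<inter> cell \<sigma> j z) = cell_content \<sigma> s (\<Union>z'\<in>parent_key -` {z}. B \<inter> cell \<sigma> (Suc j) z')"
      unfolding cell_children[of \<sigma> j z] by simp
    also have "\<dots> \<le> (\<Sum>z'\<in>parent_key -` {z}. cell_content \<sigma> s (B \<inter> cell \<sigma> (Suc j) z'))"
      by (intro net_content_finite_UN_le finite_parent_fiber) simp
    also have "\<dots> = (\<Sum>z'\<in>parent_key -` {z}. ennreal (\<mu> (Suc j) z'))"
      using top by (simp add: \<mu>_def)
    also have "\<dots> = ennreal (\<Sum>z'\<in>parent_key -` {z}. \<mu> (Suc j) z')"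
      by (simp add: \<mu>_def)
    finally show ?thesis unfolding \<mu>_def[of j z]
      by (intro enn2real_leI sum_nonneg) (simp_all add: \<mu>_def)
  qed
  obtain wt where wt: "\<And>j z. 0 \<le> wt j z" "\<And>j z. wt j z \<le> \<mu> j z" "wt 0 = \<mu> 0"
    "\<And>j i z. finite ((parent_key ^^ i) -` {z}) \<and> (\<Sum>z'\<in>(parent_key ^^ i) -` {z}. wt (j + i) z') = wt j z"
    by (rule tree_flow[where \<mu> = \<mu> and par = parent_key, OF \<mu>0 finite_parent_fiber sub]) blast
  have finP: "finite ((parent_key ^^ i) -` {z :: 'n \<Rightarrow> int})" for i z
    using wt(4)[of i z 0] by simp
  define F where "F = (parent_key ^^ k) -` {z0}"
  define I where "I = {z\<in>F. B \<inter> cell \<sigma> k z \<noteq> {}}"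
  have finF: "finite F" using wt(4)[of k z0 0] by (simp add: F_def)
  then have finI: "finite I" by (simp add: I_def)
  have "\<forall>z\<in>I. \<exists>x y. y \<in> B \<inter> cell \<sigma> k z \<and> x \<in> K \<and> dist x y \<le> L k"
    using K unfolding I_def L_def by blast
  then obtain p q where pq: "\<And>z. z \<in> I \<Longrightarrow> q z \<in> B \<inter> cell \<sigma> k z" "\<And>z. z \<in> I \<Longrightarrow> p z \<in> K"
    "\<And>z. z \<in> I \<Longrightarrow> dist (p z) (q z) \<le> L k" by metis
  \<comment> \<open>Cells missing \<open>B\<close> have content 0, so restricting to
    \<open>I\<close> loses no mass.\<close>
  have w0: "wt k z = 0" if "B \<inter> cell \<sigma> k z = {}" for z
    using wt(1,2)[of k z] that by (simp add: \<mu>_def)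
  have tot: "sum (wt k) I = \<mu> 0 z0"
  proof -
    have "sum (wt k) I = sum (wt k) F" using finF w0 by (intro sum.mono_neutral_left) (auto simp: I_def)
    also have "\<dots> = \<mu> 0 z0" using wt(4)[of k z0 0] wt(3) by (simp add: F_def)
    finally show ?thesis .
  qed
  show ?thesis
  proof (rule that[of I "wt k" p])
    show "sum (wt k) I = enn2real (cell_content \<sigma> s B)"
      using B unfolding tot \<mu>_def by (simp add: Int_absorb2)
    fix x r assume r: "1 / (\<sigma> * 2 ^ k) \<le> r"
    then have Lkr: "L k \<le> r" by (simp add: L_def)
    \<comment> \<open>The coarsest generation with side at most \<open>r\<close>. If it is 0, the
      total mass is already small enough; otherwise \<open>r\<close> and \<open>L j\<close> agree up
      to a factor 2.\<close>
    define j where "j = (LEAST i. L i \<le> r)"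
    have j: "L j \<le> r" "j \<le> k" unfolding j_def using Lkr by (auto intro: LeastI Least_le)
    let ?S = "{z \<in> I. norm (p z - x) \<le> r}"
    have Lr: "L j powr s \<le> r powr s" using j L0[of j] s by (intro powr_mono2) auto
    show "(\<Sum>z\<in>?S. wt k z) \<le> 9 ^ CARD('n) * real CARD('n) powr s * r powr s"
    proof (cases j)
      case 0
      have "(\<Sum>z\<in>?S. wt k z) \<le> sum (wt k) I" using finI wt(1) by (intro sum_mono2) auto
      also have "\<dots> \<le> 1 * (n powr s * L j powr s)" unfolding tot using \<mu>_le[of 0 z0] 0 by simp
      also have "\<dots> \<le> 9 ^ CARD('n) * (n powr s * r powr s)"
        using Lr by (intro mult_mono) auto
      finally show ?thesis by (simp add: n_def mult_ac)
    next
      case (Suc j')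
      have "\<not> L j' \<le> r" using not_less_Least[of j' "\<lambda>i. L i \<le> r"] Suc by (simp add: j_def[symmetric])
      moreover have "L j' = 2 * L j" by (simp add: L_def Suc)
      ultimately have r2: "r < 2 * L j" by simp
      let ?U = "{u. \<forall>i. \<bar>u i - cell_key \<sigma> j x i\<bar> \<le> 4}"
      have sub: "?S \<subseteq> (\<Union>u\<in>?U. (parent_key ^^ (k - j)) -` {u})"
      proof
        fix z assume z: "z \<in> ?S"
        have "norm (q z - x) \<le> norm (p z - x) + dist (p z) (q z)"
          by (metis dist_commute dist_norm dist_triangle add.commute)
        \<comment> \<open>The radius plus the displacement of the atom is at most
          \<open>2 * r\<close>, which is below \<open>4 * L j\<close>. The keys thus differ by at
          most 4 in each coordinate, which leaves 9 values and explains the factor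
          \<open>9 ^ CARD('n)\<close>.\<close>
        then have qx: "norm (q z - x) \<le> 4 * L j" using z pq(3)[of z] Lkr r2 by auto
        have key: "cell_key \<sigma> k (q z) = z" using pq(1)[of z] z by (simp add: cell_def)
        have "(parent_key ^^ (k - j)) z = cell_key \<sigma> j (q z)"
          using funpow_parent_cell_key[of "k - j" \<sigma> j "q z"] j(2) key by simp
        moreover have "\<bar>cell_key \<sigma> j (q z) i - cell_key \<sigma> j x i\<bar> \<le> 4" for i
        proof -
          have "\<bar>q z $ i - x $ i\<bar> \<le> 4 * L j"
            using component_le_norm_cart[of "q z - x" i] qx by simp
          then have "\<bar>q z $ i - x $ i\<bar> * (\<sigma> * 2 ^ j) \<le> 4"
            using \<sigma> by (simp add: L_def pos_le_divide_eq)
          moreover have "\<sigma> * 2 ^ j * q z $ i - \<sigma> * 2 ^ j * x $ i = (q z $ i - x $ i) * (\<sigma> * 2 ^ j)"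
            by (simp add: algebra_simps)
          ultimately have "\<bar>\<sigma> * 2 ^ j * q z $ i - \<sigma> * 2 ^ j * x $ i\<bar> \<le> 4"
            using \<sigma> by (simp add: abs_mult)
          then show ?thesis unfolding cell_key_def by linarith
        qed
        ultimately show "z \<in> (\<Union>u\<in>?U. (parent_key ^^ (k - j)) -` {u})" by auto
      qed
      have "(\<Sum>z\<in>?S. wt k z) \<le> (\<Sum>z\<in>(\<Union>u\<in>?U. (parent_key ^^ (k - j)) -` {u}). wt k z)"
        using wt(1) by (intro sum_mono2 sub finite_UN_I finite_key_box finP) auto
      also have "\<dots> = (\<Sum>u\<in>?U. \<Sum>z\<in>(parent_key ^^ (k - j)) -` {u}. wt k z)"
        by (intro sum.UNION_disjoint finite_key_box ballI finP) auto
      also have "\<dots> = (\<Sum>u\<in>?U. wt j u)"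
        using wt(4)[of "k - j" _ j] j(2) by simp
      also have "\<dots> \<le> (\<Sum>u\<in>?U. n powr s * r powr s)"
      proof (rule sum_mono)
        fix u
        have "wt j u \<le> n powr s * L j powr s" using wt(2) \<mu>_le order_trans by blast
        also have "\<dots> \<le> n powr s * r powr s" using Lr by (intro mult_left_mono) auto
        finally show "wt j u \<le> n powr s * r powr s" .
      qed
      also have "\<dots> = 9 ^ CARD('n) * real CARD('n) powr s * r powr s"
        by (simp add: card_key_box n_def)
      finally show ?thesis .
    qed
  qed (use finI wt(1) pq(2) in auto)
qed

section \<open>Gaussian Fourier analysis\<close>

text \<open>The characteristic function of the standard normal distribution after an affine
  substitution with factor \<open>sqrt k\<close> and centre \<open>v\<close>.\<close>

lemma has_bochner_integral_gauss_cis_real: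
  fixes v w k :: real
  assumes k: "0 < k"
  shows "has_bochner_integral lborel (\<lambda>x. cis (x * w) * exp (- k * (x - v)\<^sup>2 / 2))
           (sqrt (2 * pi / k) * exp (- w\<^sup>2 / (2 * k)) * cis (v * w))"
proof -
  have std: "has_bochner_integral lborel (\<lambda>x. cis (x * u) * exp (- x\<^sup>2 / 2))
      (complex_of_real (sqrt (2 * pi) * exp (- u\<^sup>2 / 2)))" for u :: real
  proof -
    interpret real_distribution std_normal_distribution by (rule real_dist_normal_dist)
    have "has_bochner_integral std_normal_distribution (\<lambda>x. iexp (u * x)) (complex_of_real (exp (- u\<^sup>2 / 2)))"
    proof (rule has_bochner_integral_integrable[THEN has_bochner_integral_cong[THEN iffD1, rotated -1]])
      show "integrable std_normal_distribution (\<lambda>x. iexp (u * x))"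
        by (intro integrable_iexp) auto
      show "(CLINT x|std_normal_distribution. iexp (u * x)) = complex_of_real (exp (- u\<^sup>2 / 2))"
        using fun_cong[OF char_std_normal_distribution, of u] by (simp add: char_def)
    qed auto
    then have "has_bochner_integral lborel (\<lambda>x. std_normal_density x *\<^sub>R iexp (u * x)) (complex_of_real (exp (- u\<^sup>2 / 2)))"
      unfolding has_bochner_integral_iff
      by (simp add: integrable_density integral_density del: exp_of_real)
    then have "has_bochner_integral lborel (\<lambda>x. complex_of_real (sqrt (2 * pi)) * (std_normal_density x *\<^sub>R iexp (u * x)))
        (complex_of_real (sqrt (2 * pi)) * complex_of_real (exp (- u\<^sup>2 / 2)))"
      by (rule has_bochner_integral_mult_right)
    moreover have "complex_of_real (sqrt (2 * pi)) * (std_normal_density x *\<^sub>R iexp (u * x)) = cis (x * u) * exp (- x\<^sup>2 / 2)" for x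
      by (simp add: std_normal_density_def cis_conv_exp scaleR_conv_of_real field_simps flip: of_real_mult)
    ultimately show ?thesis by simp
  qed
  let ?c = "sqrt k"
  have c: "?c \<noteq> 0" "?c > 0" "?c\<^sup>2 = k" using k by auto
  have "has_bochner_integral lborel (\<lambda>x. cis ((- ?c * v + ?c * x) * (w / ?c)) * exp (- (- ?c * v + ?c * x)\<^sup>2 / 2))
      (complex_of_real (sqrt (2 * pi) * exp (- (w / ?c)\<^sup>2 / 2)) /\<^sub>R \<bar>?c\<bar>)"
    by (rule lborel_has_bochner_integral_real_affine_iff[OF c(1), THEN iffD1, OF std])
  then have "has_bochner_integral lborel (\<lambda>x. cis (v * w) * (cis ((- ?c * v + ?c * x) * (w / ?c)) * exp (- (- ?c * v + ?c * x)\<^sup>2 / 2)))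
      (cis (v * w) * (complex_of_real (sqrt (2 * pi) * exp (- (w / ?c)\<^sup>2 / 2)) /\<^sub>R \<bar>?c\<bar>))"
    by (rule has_bochner_integral_mult_right)
  moreover have "cis (v * w) * (cis ((- ?c * v + ?c * x) * (w / ?c)) * exp (- (- ?c * v + ?c * x)\<^sup>2 / 2))
      = cis (x * w) * exp (- k * (x - v)\<^sup>2 / 2)" for x
  proof -
    have "(- ?c * v + ?c * x) * (w / ?c) = (x - v) * w" using c by (simp add: field_simps)
    moreover have "(- ?c * v + ?c * x)\<^sup>2 = k * (x - v)\<^sup>2"
    proof -
      have "(- ?c * v + ?c * x)\<^sup>2 = ?c\<^sup>2 * (x - v)\<^sup>2" by (simp only: power2_eq_square) (simp only: algebra_simps)
      then show ?thesis unfolding c(3) .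
    qed
    moreover have "cis (v * w) * cis ((x - v) * w) = cis (x * w)"
      unfolding cis_mult by (simp add: algebra_simps)
    ultimately show ?thesis by (simp add: mult.assoc[symmetric])
  qed
  moreover have "cis (v * w) * (complex_of_real (sqrt (2 * pi) * exp (- (w / ?c)\<^sup>2 / 2)) /\<^sub>R \<bar>?c\<bar>)
      = sqrt (2 * pi / k) * exp (- w\<^sup>2 / (2 * k)) * cis (v * w)"
    using k c by (simp add: power_divide real_sqrt_divide scaleR_conv_of_real field_simps)
  ultimately show ?thesis by simp
qed

lemma has_bochner_integral_lborel_prod:
  fixes f :: "'a::euclidean_space \<Rightarrow> real \<Rightarrow> complex"
  assumes f: "\<And>b. b \<in> Basis \<Longrightarrow> has_bochner_integral lborel (f b) (F b)"
  shows "has_bochner_integral lborel (\<lambda>x. \<Prod>b\<in>Basis. f b (x \<bullet> b)) (\<Prod>b\<in>Basis. F b)"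
proof -
  interpret product_sigma_finite "\<lambda>_::'a. lborel::real measure" ..
  let ?T = "\<lambda>g. \<Sum>b\<in>Basis. g b *\<^sub>R b"
  have T: "?T \<in> measurable (\<Pi>\<^sub>M b\<in>Basis. lborel) (borel :: 'a measure)" by measurable
  have fi: "integrable lborel (f b)" "integral\<^sup>L lborel (f b) = F b" if "b \<in> Basis" for b
    using f[OF that] by (auto simp: has_bochner_integral_iff)
  have fm: "f b \<in> borel_measurable borel" if "b \<in> Basis" for b
    using borel_measurable_integrable[OF fi(1)[OF that]] by simp
  have m: "(\<lambda>x. \<Prod>b\<in>Basis. f b (x \<bullet> b)) \<in> borel_measurable (borel :: 'a measure)"
    by (intro borel_measurable_prod measurable_compose[OF _ fm]) auto
  have eq: "(\<Prod>b\<in>Basis. f b (?T g \<bullet> b)) = (\<Prod>b\<in>Basis. f b (g b))" for g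
    by (intro prod.cong refl) (simp add: inner_sum_left inner_Basis if_distrib cong: if_cong)
  have "integrable (\<Pi>\<^sub>M b\<in>Basis. lborel) (\<lambda>g. \<Prod>b\<in>Basis. f b (g b))"
    by (intro product_integrable_prod fi) auto
  moreover have "(\<integral>g. (\<Prod>b\<in>Basis. f b (g b)) \<partial>(\<Pi>\<^sub>M b\<in>Basis. lborel)) = (\<Prod>b\<in>Basis. F b)"
    by (subst product_integral_prod) (auto simp: fi)
  ultimately show ?thesis
    unfolding lborel_eq[where 'a='a] has_bochner_integral_iff integrable_distr_eq[OF T m] integral_distr[OF T m] eq
    by simp
qed

text \<open>The squared norm and the inner product are sums over \<open>Basis\<close>, so the
  integral is a product of one-dimensional ones; the real part is taken at the end.\<close>

lemma has_bochner_integral_gauss_cos: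
  fixes v w :: "'a::euclidean_space"
  assumes k: "0 < k"
  shows "has_bochner_integral lborel (\<lambda>x. exp (- k * (norm (x - v))\<^sup>2 / 2) * cos (x \<bullet> w))
           (sqrt (2 * pi / k) ^ DIM('a) * exp (- (norm w)\<^sup>2 / (2 * k)) * cos (v \<bullet> w))"
proof -
  have nrm: "(norm z)\<^sup>2 = (\<Sum>b\<in>Basis. (z \<bullet> b)\<^sup>2)" for z :: 'a
    unfolding power2_norm_eq_inner euclidean_inner[of z z] by (simp only: power2_eq_square)
  have cisprod: "(\<Prod>b\<in>Basis. cis ((z \<bullet> b) * (w \<bullet> b))) = cis (z \<bullet> w)" for z :: 'a
    unfolding euclidean_inner[of z w] cis_conv_exp by (simp add: sum_distrib_left exp_sum)
  let ?f = "\<lambda>b x. cis (x * (w \<bullet> b)) * exp (- k * (x - v \<bullet> b)\<^sup>2 / 2)"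
  let ?F = "\<lambda>b. sqrt (2 * pi / k) * exp (- (w \<bullet> b)\<^sup>2 / (2 * k)) * cis ((v \<bullet> b) * (w \<bullet> b))"
  have "has_bochner_integral lborel (\<lambda>x::'a. \<Prod>b\<in>Basis. ?f b (x \<bullet> b)) (\<Prod>b\<in>Basis. ?F b)"
    by (intro has_bochner_integral_lborel_prod has_bochner_integral_gauss_cis_real k)
  also have "(\<lambda>x::'a. \<Prod>b\<in>Basis. ?f b (x \<bullet> b)) = (\<lambda>x. exp (- k * (norm (x - v))\<^sup>2 / 2) * cis (x \<bullet> w))"
  proof
    fix x :: 'a
    have "(\<Prod>b\<in>Basis. exp (- k * (x \<bullet> b - v \<bullet> b)\<^sup>2 / 2)) = exp (- k * (norm (x - v))\<^sup>2 / 2)"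
      unfolding nrm by (simp add: exp_sum[symmetric] sum_distrib_left sum_divide_distrib inner_diff_left sum_negf)
    then show "(\<Prod>b\<in>Basis. ?f b (x \<bullet> b)) = exp (- k * (norm (x - v))\<^sup>2 / 2) * cis (x \<bullet> w)"
      unfolding prod.distrib cisprod of_real_prod[symmetric] by (simp only: mult.commute)
  qed
  also have "(\<Prod>b\<in>Basis. ?F b) = sqrt (2 * pi / k) ^ DIM('a) * exp (- (norm w)\<^sup>2 / (2 * k)) * cis (v \<bullet> w)"
  proof -
    have "(\<Prod>b\<in>Basis. exp (- (w \<bullet> b)\<^sup>2 / (2 * k))) = exp (- (norm w)\<^sup>2 / (2 * k))"
      unfolding nrm by (simp add: exp_sum[symmetric] sum_divide_distrib sum_negf)
    then show ?thesis
      by (simp add: prod.distrib cisprod flip: of_real_prod)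
  qed
  finally have "has_bochner_integral lborel (\<lambda>x. Re (exp (- k * (norm (x - v))\<^sup>2 / 2) * cis (x \<bullet> w)))
      (Re (sqrt (2 * pi / k) ^ DIM('a) * exp (- (norm w)\<^sup>2 / (2 * k)) * cis (v \<bullet> w)))"
    by (rule has_bochner_integral_bounded_linear[OF bounded_linear_Re])
  then show ?thesis by (simp flip: of_real_power of_real_mult)
qed

section \<open>Gaussian sums and elementary bounds\<close>

lemma summable_powr_exp: "summable (\<lambda>j. (real j + 1) powr s * exp (- real j))"
proof (rule summable_comparison_test_bigo)
  have "norm (exp (-1/2) :: real) < 1" by simp
  then show "summable (\<lambda>j. norm (exp (-1/2 :: real) ^ j))"
    unfolding norm_power by (intro summable_geometric) simp
  have "(\<lambda>j. (real j + 1) powr s * exp (- real j)) \<in> O(\<lambda>j. exp (- real j / 2))"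
    by real_asymp
  also have "(\<lambda>j. exp (- real j / 2)) = (\<lambda>j. exp (-1/2 :: real) ^ j)"
    by (simp add: exp_of_nat_mult[symmetric])
  finally show "(\<lambda>j. (real j + 1) powr s * exp (- real j)) \<in> O(\<lambda>j. exp (-1/2 :: real) ^ j)" .
qed

text \<open>The mass \<open>(j + 1) powr s\<close> allowed in the shell number \<open>j\<close> is
  summed against the bound \<open>exp (1 - j)\<close> for the Gaussian there.\<close>

definition gauss_const :: "real \<Rightarrow> real" where
  "gauss_const s = exp 1 * (\<Sum>j. (real j + 1) powr s * exp (- real j))"

lemma gauss_const_nonneg: "0 \<le> gauss_const s"
  unfolding gauss_const_def by (intro mult_nonneg_nonneg suminf_nonneg summable_powr_exp) auto

text \<open>The points are sorted into shells of width \<open>r0\<close> about \<open>x\<close>. The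
  shell \<open>k\<close> lies in the ball of radius \<open>(k + 1) * r0\<close>, so only radii at
  least \<open>r0\<close> are fed to \<open>frost\<close>.\<close>

lemma frostman_gauss_le:
  fixes p :: "'i \<Rightarrow> 'a::real_normed_vector"
  assumes fin: "finite I" and w: "\<And>i. i \<in> I \<Longrightarrow> 0 \<le> w i" and r0: "0 < r0" and C: "0 \<le> C"
    and frost: "\<And>x r. r0 \<le> r \<Longrightarrow> (\<Sum>i | i \<in> I \<and> norm (p i - x) \<le> r. w i) \<le> C * r powr s"
  shows "(\<Sum>i\<in>I. w i * exp (- (norm (p i - x) / r0)\<^sup>2 / 4)) \<le> C * gauss_const s * r0 powr s"
proof -
  define v where "v i = norm (p i - x) / r0" for i
  define j where "j i = nat \<lfloor>v i\<rfloor>" for i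
  have v0: "0 \<le> v i" for i using r0 by (simp add: v_def)
  have j: "real (j i) \<le> v i" "v i \<le> real (j i) + 1" for i
    using v0[of i] unfolding j_def by linarith+
  have "(\<Sum>i\<in>I. w i * exp (- (v i)\<^sup>2 / 4)) \<le> (\<Sum>i\<in>I. w i * (exp 1 * exp (- real (j i))))"
  proof (intro sum_mono mult_left_mono w)
    fix i
    \<comment> \<open>The square yields the linear bound 1 - v for the exponent - v^2 / 4; its
      constant term is the factor \<open>exp 1\<close>.\<close>
    have "0 \<le> (v i / 2 - 1)\<^sup>2" by simp
    then have "- (v i)\<^sup>2 / 4 \<le> 1 - v i" by (simp add: power2_eq_square field_simps)
    then have "- (v i)\<^sup>2 / 4 \<le> 1 + - real (j i)" using j(1)[of i] by linarith
    then show "exp (- (v i)\<^sup>2 / 4) \<le> exp 1 * exp (- real (j i))"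
      unfolding exp_add[symmetric] by simp
  qed
  also have "\<dots> = (\<Sum>k\<in>j ` I. \<Sum>i\<in>{i\<in>I. j i = k}. w i * (exp 1 * exp (- real (j i))))"
    by (rule sum.image_gen[OF fin])
  also have "\<dots> = (\<Sum>k\<in>j ` I. exp 1 * exp (- real k) * (\<Sum>i\<in>{i\<in>I. j i = k}. w i))"
    unfolding sum_distrib_left by (intro sum.cong refl) auto
  also have "\<dots> \<le> (\<Sum>k\<in>j ` I. exp 1 * exp (- real k) * (C * ((real k + 1) * r0) powr s))"
  proof (intro sum_mono mult_left_mono)
    fix k
    have "(\<Sum>i\<in>{i\<in>I. j i = k}. w i) \<le> (\<Sum>i | i \<in> I \<and> norm (p i - x) \<le> (real k + 1) * r0. w i)"
    proof (rule sum_mono2)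
      show "{i\<in>I. j i = k} \<subseteq> {i \<in> I. norm (p i - x) \<le> (real k + 1) * r0}"
      proof safe
        fix i
        have "norm (p i - x) = v i * r0" using r0 by (simp add: v_def)
        also have "\<dots> \<le> (real (j i) + 1) * r0" using j(2)[of i] r0 by (intro mult_right_mono) auto
        finally show "norm (p i - x) \<le> (real (j i) + 1) * r0" .
      qed
    qed (use fin w in auto)
    also have "\<dots> \<le> C * ((real k + 1) * r0) powr s"
      using r0 by (intro frost) (simp add: algebra_simps)
    finally show "(\<Sum>i\<in>{i\<in>I. j i = k}. w i) \<le> C * ((real k + 1) * r0) powr s" .
  qed auto
  also have "\<dots> = C * r0 powr s * exp 1 * (\<Sum>k\<in>j ` I. (real k + 1) powr s * exp (- real k))"
    unfolding sum_distrib_left using r0 by (intro sum.cong refl) (simp add: powr_mult)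
  also have "\<dots> \<le> C * r0 powr s * exp 1 * (\<Sum>k. (real k + 1) powr s * exp (- real k))"
    using C fin by (intro mult_left_mono sum_le_suminf summable_powr_exp) auto
  finally show ?thesis by (simp add: v_def gauss_const_def mult_ac)
qed

lemma integrable_max_powr:
  assumes "1 < q"
  shows "integrable lborel (\<lambda>t::real. max 1 \<bar>t\<bar> powr (- q))"
proof -
  define g where "g t = indicator {1..} t * t powr (- q)" for t :: real
  have "(\<lambda>t. t powr (- q)) integrable_on {1..}"
    using has_integral_powr_to_inf[of "- q" 1] assms by auto
  then have "(\<lambda>t. t powr (- q)) absolutely_integrable_on {1..}"
    by (rule nonnegative_absolutely_integrable_1) auto
  then have "integrable lebesgue g"
    unfolding set_integrable_def g_def by simp
  moreover have gm: "g \<in> borel_measurable borel" unfolding g_def by measurable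
  ultimately have g: "integrable lborel g"
    using integrable_completion[of g lborel] by simp
  have g': "integrable lborel (\<lambda>t. g (- t))"
    using lborel_integrable_real_affine[OF g, of "-1" 0] by simp
  have "integrable lborel (\<lambda>t. indicator {-1..1} t + g t + g (- t) :: real)"
    by (intro Bochner_Integration.integrable_add g g' integrable_real_indicator) auto
  then show ?thesis
  proof (rule Bochner_Integration.integrable_bound)
    show "AE t in lborel. norm (max 1 \<bar>t\<bar> powr (- q)) \<le> norm (indicator {-1..1} t + g t + g (- t))"
      by (intro AE_I2) (auto simp: g_def indicator_def max_def)
  qed measurable
qed

text \<open>Extracts decay in \<open>x\<close> uniformly over the centres. If
  \<open>norm x \<le> 2 * R * T\<close>, the factor \<open>exp (R\<^sup>2 / 4)\<close> pays for it;
  otherwise the shift by \<open>t *\<^sub>R a\<close> removes at most half of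
  \<open>norm x\<close>.\<close>

lemma gauss_shift_le:
  fixes x a :: "'a::real_inner"
  assumes T: "1 \<le> T" "\<bar>t\<bar> \<le> T" and R: "norm a \<le> R"
  shows "exp (- (norm (x - t *\<^sub>R a))\<^sup>2 / 4) \<le> exp (R\<^sup>2 / 4) * exp (- (norm x)\<^sup>2 / (16 * T\<^sup>2))"
proof -
  have R0: "0 \<le> R" using R norm_ge_zero order_trans by blast
  have "- (norm (x - t *\<^sub>R a))\<^sup>2 / 4 \<le> R\<^sup>2 / 4 + - (norm x)\<^sup>2 / (16 * T\<^sup>2)"
  proof (cases "norm x \<le> 2 * R * T")
    case True
    then have "(norm x)\<^sup>2 \<le> (2 * R * T)\<^sup>2" by (rule power_mono) simp
    then have "(norm x)\<^sup>2 / (16 * T\<^sup>2) \<le> R\<^sup>2 / 4"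
      using T by (simp add: field_simps power_mult_distrib)
    moreover have "- (norm (x - t *\<^sub>R a))\<^sup>2 / 4 \<le> 0" by simp
    ultimately show ?thesis by linarith
  next
    case False
    have "norm (t *\<^sub>R a) \<le> T * R" using T R R0 by (auto intro!: mult_mono)
    then have "norm x / 2 \<le> norm (x - t *\<^sub>R a)"
      using False norm_triangle_ineq2[of x "t *\<^sub>R a"] by (simp add: mult.commute mult.left_commute)
    then have "(norm x / 2)\<^sup>2 \<le> (norm (x - t *\<^sub>R a))\<^sup>2" by (rule power_mono) simp
    moreover have "(norm x)\<^sup>2 / (16 * T\<^sup>2) \<le> (norm x)\<^sup>2 / (16 * 1)"
      using T by (intro divide_left_mono mult_left_mono) auto
    ultimately have "(norm x)\<^sup>2 / (16 * T\<^sup>2) \<le> (norm (x - t *\<^sub>R a))\<^sup>2 / 4"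
      using power_divide[of "norm x" 2 2] by simp
    moreover have "0 \<le> R\<^sup>2 / 4" by simp
    ultimately show ?thesis unfolding minus_divide_left[symmetric] by linarith
  qed
  then show ?thesis unfolding exp_add[symmetric] by simp
qed

text \<open>Below scale \<open>d\<close> the Frostman gain stops, but the Gaussian cut-off takes
  over. With \<open>u = d * T\<close> larger than 1, the claim reduces to
  \<open>2 * s * ln u - u\<^sup>2 / 2 \<le> 2 * s\<^sup>2\<close>, which follows from
  \<open>ln u \<le> u\<close> and a square.\<close>

lemma powr_exp_bound:
  fixes d s t :: real
  assumes "0 < d" "d \<le> 1" "0 < s"
  shows "max (1 / max 1 \<bar>t\<bar>) d powr (2 * s) * exp (- d\<^sup>2 * t\<^sup>2 / 2)
    \<le> exp (2 * s\<^sup>2) * max 1 \<bar>t\<bar> powr (- 2 * s)"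
proof -
  define T where "T = max 1 \<bar>t\<bar>"
  have T: "1 \<le> T" by (simp add: T_def)
  show ?thesis
  proof (cases "d \<le> 1 / T")
    case True
    then have mx: "max (1 / T) d = T powr (- 1)" using T by (simp add: powr_minus_divide)
    have "max (1 / T) d powr (2 * s) = T powr (- 2 * s)" unfolding mx powr_powr by simp
    moreover have "- d\<^sup>2 * t\<^sup>2 / 2 \<le> 0" "0 \<le> 2 * s\<^sup>2" by simp_all
    then have "exp (- d\<^sup>2 * t\<^sup>2 / 2) \<le> exp (2 * s\<^sup>2)" by (meson exp_le_cancel_iff order_trans)
    ultimately show ?thesis unfolding T_def[symmetric]
      by (metis mult.commute mult_right_mono powr_ge_zero)
  next
    case False
    define u where "u = d * T"
    have u: "1 < u" using False T by (simp add: u_def field_simps)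
    \<comment> \<open>\<open>T = 1\<close> would give \<open>u = d \<le> 1\<close>.\<close>
    then have "T \<noteq> 1" using assms by (auto simp: u_def)
    then have Tt: "T = \<bar>t\<bar>" by (auto simp: T_def max_def split: if_splits)
    have d: "d = u * T powr (- 1)" using T by (simp add: u_def powr_minus_divide)
    have "max (1 / T) d = d" using False by simp
    also have "d powr (2 * s) = u powr (2 * s) * T powr (- 2 * s)"
    proof -
      have "d powr (2 * s) = (u * T powr (- 1)) powr (2 * s)" using d by simp
      also have "\<dots> = u powr (2 * s) * T powr (- 2 * s)"
        using u by (subst powr_mult) (auto simp only: powr_powr, simp_all)
      finally show ?thesis .
    qed
    finally have 1: "max (1 / T) d powr (2 * s) = u powr (2 * s) * T powr (- 2 * s)" .
    have "ln u \<le> u" using ln_le_minus_one[of u] u by simp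
    then have "2 * s * ln u \<le> 2 * s * u" using assms by (intro mult_left_mono) auto
    moreover have "0 \<le> (u - 2 * s)\<^sup>2" by simp
    ultimately have "2 * s * ln u + - u\<^sup>2 / 2 \<le> 2 * s\<^sup>2"
      by (simp add: power2_eq_square algebra_simps)
    moreover have "u powr (2 * s) = exp (2 * s * ln u)" using u by (simp add: powr_def)
    ultimately have "u powr (2 * s) * exp (- u\<^sup>2 / 2) \<le> exp (2 * s\<^sup>2)"
      by (simp only: exp_add[symmetric] exp_le_cancel_iff)
    then have "u powr (2 * s) * exp (- u\<^sup>2 / 2) * T powr (- 2 * s) \<le> exp (2 * s\<^sup>2) * T powr (- 2 * s)"
      by (intro mult_right_mono) auto
    moreover have "- u\<^sup>2 / 2 = - d\<^sup>2 * t\<^sup>2 / 2" by (simp add: u_def Tt power_mult_distrib)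
    ultimately show ?thesis unfolding T_def[symmetric] 1 by (simp add: mult_ac)
  qed
qed

section \<open>The averaged energy of the projections\<close>

lemma has_bochner_integral_mono:
  fixes f g :: "'a \<Rightarrow> real"
  assumes "has_bochner_integral M f a" "has_bochner_integral M g b" "\<And>x. f x \<le> g x"
  shows "a \<le> b"
  using assms integral_mono[of M f g] by (simp add: has_bochner_integral_iff)

text \<open>The form is the squared modulus of the Fourier transform of the weighted points at
  \<open>x\<close>, written with real functions.\<close>

lemma trig_form_nonneg:
  fixes p :: "'i \<Rightarrow> 'a::real_inner"
  shows "0 \<le> (\<Sum>y\<in>I. \<Sum>z\<in>I. w y * w z * cos (x \<bullet> (p y - p z)))"
proof -
  have "(\<Sum>y\<in>I. \<Sum>z\<in>I. w y * w z * cos (x \<bullet> (p y - p z)))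
      = (\<Sum>y\<in>I. w y * cos (x \<bullet> p y)) * (\<Sum>z\<in>I. w z * cos (x \<bullet> p z))
      + (\<Sum>y\<in>I. w y * sin (x \<bullet> p y)) * (\<Sum>z\<in>I. w z * sin (x \<bullet> p z))"
    unfolding sum_product sum.distrib[symmetric]
    by (intro sum.cong refl) (simp add: inner_diff_right cos_diff algebra_simps)
  then show ?thesis by simp
qed

text \<open>A Gaussian average of the squared Fourier transform is an energy with a Gaussian kernel;
  it is used in both directions in the bound for \<open>spectral\<close>.\<close>

lemma has_bochner_integral_gauss_trig_form:
  fixes p :: "'i \<Rightarrow> 'a::euclidean_space"
  assumes k: "0 < k"
  shows "has_bochner_integral lborel
      (\<lambda>x. exp (- k * (norm (x - v))\<^sup>2 / 2) * (\<Sum>y\<in>I. \<Sum>z\<in>I. w y * w z * cos (x \<bullet> (p y - p z))))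
      (sqrt (2 * pi / k) ^ DIM('a) * (\<Sum>y\<in>I. \<Sum>z\<in>I. w y * w z *
          (exp (- (norm (p y - p z))\<^sup>2 / (2 * k)) * cos (v \<bullet> (p y - p z)))))"
proof -
  have "has_bochner_integral lborel
      (\<lambda>x. \<Sum>y\<in>I. \<Sum>z\<in>I. w y * w z * (exp (- k * (norm (x - v))\<^sup>2 / 2) * cos (x \<bullet> (p y - p z))))
      (\<Sum>y\<in>I. \<Sum>z\<in>I. w y * w z * (sqrt (2 * pi / k) ^ DIM('a) * exp (- (norm (p y - p z))\<^sup>2 / (2 * k)) * cos (v \<bullet> (p y - p z))))"
    by (intro has_bochner_integral_sum has_bochner_integral_mult_right has_bochner_integral_gauss_cos k)
  then show ?thesis by (simp add: sum_distrib_left mult_ac)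
qed

text \<open>A finitely supported measure with the Frostman bound down to the scale \<open>d\<close>
  only. The atoms are indexed, so several may sit at the same point.\<close>

locale frostman_points =
  fixes I :: "'i set" and p :: "'i \<Rightarrow> 'a::euclidean_space" and w :: "'i \<Rightarrow> real" and R C m s d :: real
  assumes fin: "finite I" and w: "\<And>i. i \<in> I \<Longrightarrow> 0 \<le> w i" and pR: "\<And>i. i \<in> I \<Longrightarrow> norm (p i) \<le> R"
    and C: "0 \<le> C" and m: "sum w I \<le> m" and s: "0 < s" and d: "0 < d" "d \<le> 1"
    and frost: "\<And>x r. d \<le> r \<Longrightarrow> (\<Sum>i | i \<in> I \<and> norm (p i - x) \<le> r. w i) \<le> C * r powr s"
begin

text \<open>
  Up to constants, the unit-scale mollification of the squared Fourier transform of \<open>w\<close> at the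
  frequency \<open>t a\<close>, averaged over \<open>a\<close>.
\<close>

definition spectral :: "real \<Rightarrow> real" where
  "spectral t = (\<Sum>a\<in>I. w a * (\<Sum>y\<in>I. \<Sum>z\<in>I. w y * w z *
      (exp (- (norm (p y - p z))\<^sup>2 / 2) * cos ((t *\<^sub>R p a) \<bullet> (p y - p z)))))"

text \<open>After dilation by \<open>t\<close>, a unit ball about \<open>x\<close> corresponds to a
  ball of radius \<open>1 / \<bar>t\<bar>\<close> about \<open>x / t\<close>, whose mass the
  Frostman bound controls at the scale \<open>max (1 / T) d\<close>. The Gaussian is split into two
  equal factors, one for this bound and one for the decay in \<open>x\<close>.\<close>

lemma gauss_sum_le:
  fixes t :: real
  defines "T \<equiv> max 1 \<bar>t\<bar>"
  shows "(\<Sum>a\<in>I. w a * exp (- (norm (x - t *\<^sub>R p a))\<^sup>2 / 2))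
    \<le> exp (R\<^sup>2 / 4) * (C * gauss_const s + m) * max (1 / T) d powr s * exp (- (norm x)\<^sup>2 / (16 * T\<^sup>2))"
proof -
  define r where "r = max (1 / T) d"
  have T: "1 \<le> T" "\<bar>t\<bar> \<le> T" by (auto simp: T_def)
  have m0: "0 \<le> m" using m sum_nonneg[of I w] w by force
  have Cg: "0 \<le> C * gauss_const s" using C gauss_const_nonneg by simp
  have r: "0 < r" "d \<le> r" using d by (auto simp: r_def)
  have "(\<Sum>a\<in>I. w a * exp (- (norm (x - t *\<^sub>R p a))\<^sup>2 / 4)) \<le> (C * gauss_const s + m) * r powr s"
  proof (cases "\<bar>t\<bar> \<le> 1")
    case True
    \<comment> \<open>For \<open>\<bar>t\<bar> \<le> 1\<close> the scale is 1 because
      \<open>d \<le> 1\<close>, and the total mass suffices; this is why \<open>m\<close> is added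
      to the constant.\<close>
    then have "r = 1" using d by (auto simp: r_def T_def)
    have "(\<Sum>a\<in>I. w a * exp (- (norm (x - t *\<^sub>R p a))\<^sup>2 / 4)) \<le> (\<Sum>a\<in>I. w a * 1)"
      by (intro sum_mono mult_left_mono w) auto
    also have "\<dots> \<le> (C * gauss_const s + m) * r powr s" using m Cg \<open>r = 1\<close> by simp
    finally show ?thesis .
  next
    case False
    then have Tt: "T = \<bar>t\<bar>" "t \<noteq> 0" by (auto simp: T_def)
    have rt: "1 / r \<le> \<bar>t\<bar>"
    proof -
      have "1 / T \<le> r" by (simp add: r_def)
      then show ?thesis using r T Tt by (simp add: field_simps)
    qed
    have "(\<Sum>a\<in>I. w a * exp (- (norm (x - t *\<^sub>R p a))\<^sup>2 / 4))
        \<le> (\<Sum>a\<in>I. w a * exp (- (norm (p a - (1 / t) *\<^sub>R x) / r)\<^sup>2 / 4))"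
    proof (intro sum_mono mult_left_mono w)
      fix a
      have "norm (p a - (1 / t) *\<^sub>R x) / r \<le> \<bar>t\<bar> * norm (p a - (1 / t) *\<^sub>R x)"
        using mult_right_mono[OF rt, of "norm (p a - (1 / t) *\<^sub>R x)"] by simp
      also have "\<dots> = norm (t *\<^sub>R (p a - (1 / t) *\<^sub>R x))" by simp
      also have "t *\<^sub>R (p a - (1 / t) *\<^sub>R x) = - (x - t *\<^sub>R p a)" using Tt by (simp add: scaleR_diff_right)
      finally have "norm (p a - (1 / t) *\<^sub>R x) / r \<le> norm (x - t *\<^sub>R p a)" by (simp only: norm_minus_cancel)
      then have "(norm (p a - (1 / t) *\<^sub>R x) / r)\<^sup>2 \<le> (norm (x - t *\<^sub>R p a))\<^sup>2"
        using r by (intro power_mono) auto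
      then show "exp (- (norm (x - t *\<^sub>R p a))\<^sup>2 / 4) \<le> exp (- (norm (p a - (1 / t) *\<^sub>R x) / r)\<^sup>2 / 4)"
        by simp
    qed
    also have "\<dots> \<le> C * gauss_const s * r powr s"
      using r by (intro frostman_gauss_le fin w C frost) auto
    also have "\<dots> \<le> (C * gauss_const s + m) * r powr s"
      using m0 by (intro mult_right_mono) auto
    finally show ?thesis .
  qed
  then have "exp (R\<^sup>2 / 4) * exp (- (norm x)\<^sup>2 / (16 * T\<^sup>2)) * (\<Sum>a\<in>I. w a * exp (- (norm (x - t *\<^sub>R p a))\<^sup>2 / 4))
      \<le> exp (R\<^sup>2 / 4) * exp (- (norm x)\<^sup>2 / (16 * T\<^sup>2)) * ((C * gauss_const s + m) * r powr s)"
    by (rule mult_left_mono) simp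
  moreover have "(\<Sum>a\<in>I. w a * exp (- (norm (x - t *\<^sub>R p a))\<^sup>2 / 2))
      \<le> (\<Sum>a\<in>I. exp (R\<^sup>2 / 4) * exp (- (norm x)\<^sup>2 / (16 * T\<^sup>2)) * (w a * exp (- (norm (x - t *\<^sub>R p a))\<^sup>2 / 4)))"
  proof (rule sum_mono)
    fix a assume a: "a \<in> I"
    have "exp (- (norm (x - t *\<^sub>R p a))\<^sup>2 / 2) = exp (- (norm (x - t *\<^sub>R p a))\<^sup>2 / 4) * exp (- (norm (x - t *\<^sub>R p a))\<^sup>2 / 4)"
      unfolding exp_add[symmetric] by simp
    also have "\<dots> \<le> (exp (R\<^sup>2 / 4) * exp (- (norm x)\<^sup>2 / (16 * T\<^sup>2))) * exp (- (norm (x - t *\<^sub>R p a))\<^sup>2 / 4)"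
      by (intro mult_right_mono gauss_shift_le T pR a) auto
    finally have "w a * exp (- (norm (x - t *\<^sub>R p a))\<^sup>2 / 2)
        \<le> w a * ((exp (R\<^sup>2 / 4) * exp (- (norm x)\<^sup>2 / (16 * T\<^sup>2))) * exp (- (norm (x - t *\<^sub>R p a))\<^sup>2 / 4))"
      by (rule mult_left_mono[OF _ w[OF a]])
    then show "w a * exp (- (norm (x - t *\<^sub>R p a))\<^sup>2 / 2)
        \<le> exp (R\<^sup>2 / 4) * exp (- (norm x)\<^sup>2 / (16 * T\<^sup>2)) * (w a * exp (- (norm (x - t *\<^sub>R p a))\<^sup>2 / 4))"
      by (simp only: mult_ac)
  qed
  ultimately show ?thesis
    unfolding r_def[symmetric] sum_distrib_left[symmetric] by (simp only: mult_ac)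
qed

text \<open>\<open>sqrt 8\<close> comes from the width of the dominating Gaussian, the next two
  factors from \<open>gauss_sum_le\<close>, and the last from the remaining energy.\<close>

definition spectral_const :: real where
  "spectral_const = sqrt 8 ^ DIM('a) * exp (R\<^sup>2 / 4) * (C * gauss_const s + m) * (m * (C * gauss_const s))"

text \<open>Up to a constant, \<open>spectral t\<close> is the integral of the nonnegative squared
  transform \<open>N\<close> against Gaussians centred at the points \<open>t *\<^sub>R p a\<close>.
  \<open>gauss_sum_le\<close> replaces their sum by one Gaussian of width about \<open>T\<close>,
  and integrating back gives an energy \<open>S\<close> at scale about \<open>1 / T\<close>. The
  width costs \<open>T ^ DIM('a)\<close>; the sum and \<open>S\<close> each gain a factor
  \<open>r powr s\<close>.\<close>

lemma spectral_le:
  fixes t :: real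
  defines "T \<equiv> max 1 \<bar>t\<bar>"
  shows "spectral t \<le> spectral_const * T ^ DIM('a) * max (1 / T) d powr (2 * s)"
proof -
  define r where "r = max (1 / T) d"
  define n where "n = DIM('a)"
  define N where "N x = (\<Sum>y\<in>I. \<Sum>z\<in>I. w y * w z * cos (x \<bullet> (p y - p z)))" for x
  define M where "M = exp (R\<^sup>2 / 4) * (C * gauss_const s + m)"
  have T: "1 \<le> T" by (auto simp: T_def)
  have r: "0 < r" "d \<le> r" using d by (auto simp: r_def)
  have m0: "0 \<le> m" using m sum_nonneg[of I w] w by force
  have M0: "0 \<le> M" using m0 C gauss_const_nonneg[of s] by (simp add: M_def)
  have N0: "0 \<le> N x" for x unfolding N_def by (rule trig_form_nonneg)
  \<comment> \<open>Chosen so that \<open>exp (- k * (norm x)\<^sup>2 / 2)\<close> is the decay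
    factor supplied by \<open>gauss_sum_le\<close>.\<close>
  define k where "k = 1 / (8 * T\<^sup>2)"
  have k: "0 < k" using T by (simp add: k_def)
  define S where "S = (\<Sum>y\<in>I. \<Sum>z\<in>I. w y * w z * exp (- (norm (p y - p z))\<^sup>2 / (2 * k)))"
  have "has_bochner_integral lborel
      (\<lambda>x. \<Sum>a\<in>I. w a * (exp (- 1 * (norm (x - t *\<^sub>R p a))\<^sup>2 / 2) * N x))
      (\<Sum>a\<in>I. w a * (sqrt (2 * pi / 1) ^ DIM('a) * (\<Sum>y\<in>I. \<Sum>z\<in>I. w y * w z *
          (exp (- (norm (p y - p z))\<^sup>2 / (2 * 1)) * cos ((t *\<^sub>R p a) \<bullet> (p y - p z))))))"
    unfolding N_def
    by (intro has_bochner_integral_sum has_bochner_integral_mult_right has_bochner_integral_gauss_trig_form) simp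
  then have L: "has_bochner_integral lborel
      (\<lambda>x. (\<Sum>a\<in>I. w a * exp (- (norm (x - t *\<^sub>R p a))\<^sup>2 / 2)) * N x) (sqrt (2 * pi) ^ n * spectral t)"
    unfolding spectral_def n_def by (simp add: sum_distrib_left sum_distrib_right mult_ac)
  have Rr: "has_bochner_integral lborel
      (\<lambda>x. M * r powr s * (exp (- k * (norm (x - 0))\<^sup>2 / 2) * N x))
      (M * r powr s * (sqrt (2 * pi / k) ^ n * S))"
    using has_bochner_integral_mult_right[OF has_bochner_integral_gauss_trig_form[OF k, of 0 w p I], of "M * r powr s"]
    unfolding S_def N_def n_def by simp
  have "sqrt (2 * pi) ^ n * spectral t \<le> M * r powr s * (sqrt (2 * pi / k) ^ n * S)"
  proof (rule has_bochner_integral_mono[OF L Rr])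
    fix x :: 'a
    have "- k * (norm (x - 0))\<^sup>2 / 2 = - (norm x)\<^sup>2 / (16 * T\<^sup>2)" by (simp add: k_def)
    then have "(\<Sum>a\<in>I. w a * exp (- (norm (x - t *\<^sub>R p a))\<^sup>2 / 2)) \<le> M * r powr s * exp (- k * (norm (x - 0))\<^sup>2 / 2)"
      using gauss_sum_le[of x t] unfolding M_def r_def T_def by simp
    from mult_right_mono[OF this N0[of x]]
    show "(\<Sum>a\<in>I. w a * exp (- (norm (x - t *\<^sub>R p a))\<^sup>2 / 2)) * N x
        \<le> M * r powr s * (exp (- k * (norm (x - 0))\<^sup>2 / 2) * N x)" by (simp add: mult_ac)
  qed
  also have "sqrt (2 * pi / k) = sqrt (2 * pi) * (sqrt 8 * T)"
  proof -
    have "2 * pi / k = 2 * pi * (8 * T\<^sup>2)" by (simp add: k_def)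
    moreover have "sqrt (T\<^sup>2) = T" using T by simp
    ultimately show ?thesis by (simp only: real_sqrt_mult)
  qed
  finally have "sqrt (2 * pi) ^ n * spectral t \<le> sqrt (2 * pi) ^ n * (M * r powr s * (sqrt 8 ^ n * T ^ n * S))"
    by (simp add: power_mult_distrib mult_ac)
  then have 1: "spectral t \<le> M * r powr s * (sqrt 8 ^ n * T ^ n * S)"
    by (subst (asm) mult_le_cancel_left_pos) auto
  have "S \<le> (\<Sum>y\<in>I. w y * (C * gauss_const s * r powr s))"
    unfolding S_def
  proof (rule sum_mono)
    fix y assume y: "y \<in> I"
    have "(\<Sum>z\<in>I. w z * exp (- (norm (p y - p z))\<^sup>2 / (2 * k))) \<le> (\<Sum>z\<in>I. w z * exp (- (norm (p z - p y) / r)\<^sup>2 / 4))"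
    proof (intro sum_mono mult_left_mono w)
      fix z
      \<comment> \<open>With this \<open>k\<close> the kernel is a Gaussian in \<open>4 * T\<close>
        times the distance, hence narrower than the one of scale \<open>r\<close>.\<close>
      have "1 / r \<le> T" using r T by (simp add: r_def field_simps max_def split: if_splits)
      then have "(1 / r) * norm (p z - p y) \<le> 4 * T * norm (p z - p y)"
        using T by (intro mult_right_mono) auto
      then have "(norm (p z - p y) / r)\<^sup>2 \<le> (4 * T * norm (p z - p y))\<^sup>2"
        using r by (intro power_mono) auto
      moreover have "(norm (p y - p z))\<^sup>2 / (2 * k) = (4 * T * norm (p z - p y))\<^sup>2 / 4"
        using T by (simp add: k_def power_mult_distrib norm_minus_commute)
      ultimately show "exp (- (norm (p y - p z))\<^sup>2 / (2 * k)) \<le> exp (- (norm (p z - p y) / r)\<^sup>2 / 4)"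
        by simp
    qed
    also have "\<dots> \<le> C * gauss_const s * r powr s"
      using r by (intro frostman_gauss_le fin w C frost) auto
    finally have "w y * (\<Sum>z\<in>I. w z * exp (- (norm (p y - p z))\<^sup>2 / (2 * k))) \<le> w y * (C * gauss_const s * r powr s)"
      using w[OF y] by (rule mult_left_mono)
    then show "(\<Sum>z\<in>I. w y * w z * exp (- (norm (p y - p z))\<^sup>2 / (2 * k))) \<le> w y * (C * gauss_const s * r powr s)"
      by (simp add: sum_distrib_left mult_ac)
  qed
  also have "\<dots> = sum w I * (C * gauss_const s * r powr s)" by (simp add: sum_distrib_right)
  also have "\<dots> \<le> m * (C * gauss_const s * r powr s)"
    using m C gauss_const_nonneg[of s] by (intro mult_right_mono) auto
  finally have "M * r powr s * (sqrt 8 ^ n * T ^ n * S) \<le> M * r powr s * (sqrt 8 ^ n * T ^ n * (m * (C * gauss_const s * r powr s)))"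
    using M0 T by (intro mult_left_mono) auto
  with 1 have "spectral t \<le> M * r powr s * (sqrt 8 ^ n * T ^ n * (m * (C * gauss_const s * r powr s)))" by simp
  also have "\<dots> = spectral_const * T ^ n * (r powr s * r powr s)"
    unfolding M_def n_def spectral_const_def by (simp add: mult_ac)
  also have "r powr s * r powr s = r powr (2 * s)" by (simp flip: powr_add)
  finally show ?thesis unfolding r_def n_def .
qed

text \<open>The kernel of width \<open>d\<close> is written as a Fourier integral over
  \<open>t\<close>, which turns the energy into an integral of \<open>spectral\<close>; its
  normalisation yields the factor \<open>d\<close>. The unit-scale Gaussian within
  \<open>spectral\<close> may be inserted at the cost \<open>exp (2 * R\<^sup>2)\<close>, since the
  points are at most \<open>2 * R\<close> apart. The hypothesis \<open>dim\<close> makes the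
  resulting power of \<open>T\<close> integrable.\<close>

lemma energy_le:
  assumes dim: "real DIM('a) + 1 < 2 * s"
  shows "(\<Sum>a\<in>I. w a * (\<Sum>y\<in>I. \<Sum>z\<in>I. w y * w z * exp (- (p a \<bullet> (p y - p z))\<^sup>2 / (2 * d\<^sup>2))))
    \<le> exp (2 * R\<^sup>2) * (spectral_const * exp (2 * s\<^sup>2) *
        (LBINT t. max 1 \<bar>t\<bar> powr (- (2 * s - real DIM('a))))) / sqrt (2 * pi) * d"
proof -
  define q where "q = 2 * s - real DIM('a)"
  define J where "J = (LBINT t. max 1 \<bar>t\<bar> powr (- q))"
  have q: "1 < q" using dim by (simp add: q_def)
  have m0: "0 \<le> m" using m sum_nonneg[of I w] w by force
  have K0: "0 \<le> spectral_const"
    unfolding spectral_const_def using m0 C gauss_const_nonneg[of s] by simp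
  let ?E = "\<lambda>y z. exp (- (norm (p y - p z))\<^sup>2 / 2)"
  let ?P = "\<lambda>a y z. exp (- (p a \<bullet> (p y - p z))\<^sup>2 / (2 * d\<^sup>2))"
  let ?\<Phi> = "\<Sum>a\<in>I. w a * (\<Sum>y\<in>I. \<Sum>z\<in>I. w y * w z * ?P a y z)"
  let ?\<Psi> = "\<Sum>a\<in>I. w a * (\<Sum>y\<in>I. \<Sum>z\<in>I. w y * w z * (?E y z * ?P a y z))"
  have "?\<Phi> \<le> exp (2 * R\<^sup>2) * ?\<Psi>"
    unfolding sum_distrib_left
  proof (intro sum_mono)
    fix a y z assume a: "a \<in> I" "y \<in> I" "z \<in> I"
    have "norm (p y - p z) \<le> 2 * R" using norm_triangle_ineq4[of "p y" "p z"] pR[OF a(2)] pR[OF a(3)] by linarith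
    then have "(norm (p y - p z))\<^sup>2 \<le> (2 * R)\<^sup>2" by (rule power_mono) simp
    then have "0 \<le> 2 * R\<^sup>2 + - (norm (p y - p z))\<^sup>2 / 2" by (simp add: power_mult_distrib)
    then have "1 \<le> exp (2 * R\<^sup>2) * ?E y z" unfolding exp_add[symmetric] by simp
    moreover have "0 \<le> w a * w y * w z * ?P a y z" using w a by simp
    ultimately have "w a * w y * w z * ?P a y z * 1 \<le> w a * w y * w z * ?P a y z * (exp (2 * R\<^sup>2) * ?E y z)"
      by (rule mult_left_mono)
    then show "w a * (w y * w z * ?P a y z) \<le> exp (2 * R\<^sup>2) * (w a * (w y * w z * (?E y z * ?P a y z)))"
      by (simp add: mult_ac)
  qed
  moreover have "sqrt (2 * pi) / d * ?\<Psi> \<le> spectral_const * exp (2 * s\<^sup>2) * J"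
  proof (rule has_bochner_integral_mono)
    have "has_bochner_integral lborel
      (\<lambda>t. \<Sum>a\<in>I. w a * (\<Sum>y\<in>I. \<Sum>z\<in>I. w y * w z *
        (?E y z * (exp (- d\<^sup>2 * (norm (t - 0))\<^sup>2 / 2) * cos (t \<bullet> (p a \<bullet> (p y - p z)))))))
      (\<Sum>a\<in>I. w a * (\<Sum>y\<in>I. \<Sum>z\<in>I. w y * w z *
        (?E y z * (sqrt (2 * pi / d\<^sup>2) ^ DIM(real) * exp (- (norm (p a \<bullet> (p y - p z)))\<^sup>2 / (2 * d\<^sup>2))
           * cos (0 \<bullet> (p a \<bullet> (p y - p z)))))))"
      using d by (intro has_bochner_integral_sum has_bochner_integral_mult_right has_bochner_integral_gauss_cos) simp
    moreover have "sqrt (2 * pi / d\<^sup>2) = sqrt (2 * pi) / d" using d by (simp add: real_sqrt_divide)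
    ultimately show "has_bochner_integral lborel (\<lambda>t. spectral t * exp (- d\<^sup>2 * t\<^sup>2 / 2)) (sqrt (2 * pi) / d * ?\<Psi>)"
      unfolding spectral_def by (simp add: sum_distrib_left sum_distrib_right mult_ac)
    show "has_bochner_integral lborel (\<lambda>t. spectral_const * exp (2 * s\<^sup>2) * (max 1 \<bar>t\<bar> powr (- q)))
        (spectral_const * exp (2 * s\<^sup>2) * J)"
      unfolding J_def
      by (intro has_bochner_integral_mult_right has_bochner_integral_integrable integrable_max_powr q)
    fix t :: real
    let ?T = "max 1 \<bar>t\<bar>"
    have "spectral t * exp (- d\<^sup>2 * t\<^sup>2 / 2)
        \<le> spectral_const * ?T ^ DIM('a) * max (1 / ?T) d powr (2 * s) * exp (- d\<^sup>2 * t\<^sup>2 / 2)"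
      by (intro mult_right_mono spectral_le) simp
    also have "\<dots> = spectral_const * ?T ^ DIM('a) * (max (1 / ?T) d powr (2 * s) * exp (- d\<^sup>2 * t\<^sup>2 / 2))"
      by (simp only: mult.assoc)
    also have "\<dots> \<le> spectral_const * ?T ^ DIM('a) * (exp (2 * s\<^sup>2) * ?T powr (- 2 * s))"
      using K0 d s by (intro mult_left_mono powr_exp_bound) auto
    also have "?T ^ DIM('a) = ?T powr (real DIM('a))" by (simp add: powr_realpow)
    also have "spectral_const * ?T powr (real DIM('a)) * (exp (2 * s\<^sup>2) * ?T powr (- 2 * s))
        = spectral_const * exp (2 * s\<^sup>2) * (?T powr (real DIM('a)) * ?T powr (- 2 * s))"
      by (simp only: mult_ac)
    also have "?T powr (real DIM('a)) * ?T powr (- 2 * s) = ?T powr (- q)"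
      unfolding powr_add[symmetric] q_def by simp
    finally show "spectral t * exp (- d\<^sup>2 * t\<^sup>2 / 2) \<le> spectral_const * exp (2 * s\<^sup>2) * (?T powr (- q))" .
  qed
  then have "?\<Psi> \<le> spectral_const * exp (2 * s\<^sup>2) * J / sqrt (2 * pi) * d"
    using d by (simp add: field_simps)
  then have "exp (2 * R\<^sup>2) * ?\<Psi> \<le> exp (2 * R\<^sup>2) * (spectral_const * exp (2 * s\<^sup>2) * J / sqrt (2 * pi) * d)"
    by (rule mult_left_mono) simp
  ultimately show ?thesis unfolding J_def q_def by simp
qed

end

section \<open>Spread projections\<close>

text \<open>Cauchy-Schwarz over the occupied bins. The sum of squared bin masses counts pairs in a
  common bin, and for these the kernel is at least \<open>exp (-1/2)\<close>.\<close>

lemma card_bins_bound: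
  fixes t w :: "'i \<Rightarrow> real"
  assumes fin: "finite I" and w: "\<And>i. i \<in> I \<Longrightarrow> 0 \<le> w i" and d: "0 < d"
  shows "(sum w I)\<^sup>2 \<le> real (card ((\<lambda>i. \<lfloor>t i / d\<rfloor>) ` I)) * (exp (1/2) *
    (\<Sum>y\<in>I. \<Sum>z\<in>I. w y * w z * exp (- (t y - t z)\<^sup>2 / (2 * d\<^sup>2))))"
proof -
  let ?f = "\<lambda>i. \<lfloor>t i / d\<rfloor>"
  let ?J = "?f ` I"
  define W where "W j = (\<Sum>i\<in>{i\<in>I. ?f i = j}. w i)" for j
  have "sum w I = (\<Sum>j\<in>?J. W j)" unfolding W_def by (rule sum.image_gen[OF fin])
  then have "(sum w I)\<^sup>2 = (\<Sum>j\<in>?J. W j)\<^sup>2" by simp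
  also have "\<dots> \<le> (\<Sum>j\<in>?J. (W j)\<^sup>2) * real (card ?J)"
    by (rule sum_squared_le_sum_of_squares)
  also have "(\<Sum>j\<in>?J. (W j)\<^sup>2) = (\<Sum>j\<in>?J. \<Sum>y\<in>{y\<in>I. ?f y = j}. w y * W (?f y))"
    unfolding power2_eq_square by (intro sum.cong refl) (simp add: W_def sum_distrib_right)
  also have "\<dots> = (\<Sum>y\<in>I. w y * W (?f y))" by (rule sum.image_gen[OF fin, symmetric])
  also have "\<dots> \<le> (\<Sum>y\<in>I. w y * (\<Sum>z\<in>I. w z * (exp (1/2) * exp (- (t y - t z)\<^sup>2 / (2 * d\<^sup>2)))))"
  proof (intro sum_mono mult_left_mono w)
    fix y
    have "W (?f y) = (\<Sum>z\<in>{z\<in>I. ?f z = ?f y}. w z * 1)" by (simp add: W_def)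
    also have "\<dots> \<le> (\<Sum>z\<in>{z\<in>I. ?f z = ?f y}. w z * (exp (1/2) * exp (- (t y - t z)\<^sup>2 / (2 * d\<^sup>2))))"
    proof (intro sum_mono mult_left_mono)
      fix z assume "z \<in> {z\<in>I. ?f z = ?f y}"
      then have "\<bar>t y / d - t z / d\<bar> \<le> 1" by simp linarith
      then have "(t y / d - t z / d)\<^sup>2 \<le> 1" by (simp add: abs_square_le_1)
      then have "0 \<le> 1/2 + - (t y - t z)\<^sup>2 / (2 * d\<^sup>2)"
        using d by (simp add: diff_divide_distrib[symmetric] power_divide field_simps)
      then show "1 \<le> exp (1/2) * exp (- (t y - t z)\<^sup>2 / (2 * d\<^sup>2))"
        unfolding exp_add[symmetric] by simp
    qed (use w in auto)
    also have "\<dots> \<le> (\<Sum>z\<in>I. w z * (exp (1/2) * exp (- (t y - t z)\<^sup>2 / (2 * d\<^sup>2))))"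
      using fin w by (intro sum_mono2) auto
    finally show "W (?f y) \<le> (\<Sum>z\<in>I. w z * (exp (1/2) * exp (- (t y - t z)\<^sup>2 / (2 * d\<^sup>2))))" .
  qed
  also have "\<dots> = exp (1/2) * (\<Sum>y\<in>I. \<Sum>z\<in>I. w y * w z * exp (- (t y - t z)\<^sup>2 / (2 * d\<^sup>2)))"
    by (simp add: sum_distrib_left mult_ac)
  finally show ?thesis by (simp add: mult_ac mult_right_mono)
qed

lemma emeasure_bins:
  fixes J :: "int set"
  assumes "finite J" "0 < d"
  shows "emeasure lborel (\<Union>j\<in>J. {of_int j * d ..< (of_int j + 1) * d}) = ennreal (real (card J) * d)"
proof -
  have "disjoint_family_on (\<lambda>j. {of_int j * d ..< (of_int j + 1) * d}) J"
    unfolding disjoint_family_on_def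
  proof safe
    fix i j x assume x: "x \<in> {of_int i * d ..< (of_int i + 1) * d}" "x \<in> {of_int j * d ..< (of_int j + 1) * d}" and ij: "i \<noteq> j"
    have "\<lfloor>x / d\<rfloor> = i" "\<lfloor>x / d\<rfloor> = j" using x assms(2)
      by (auto simp: floor_eq_iff field_simps)
    then show "x \<in> {}" using ij by simp
  qed
  then have "emeasure lborel (\<Union>j\<in>J. {of_int j * d ..< (of_int j + 1) * d})
      = (\<Sum>j\<in>J. emeasure lborel {of_int j * d ..< (of_int j + 1) * d})"
    using assms by (intro sum_emeasure[symmetric]) auto
  also have "\<dots> = (\<Sum>j\<in>J. ennreal d)"
    using assms by (intro sum.cong refl) (simp add: algebra_simps)
  also have "\<dots> = ennreal (real (card J) * d)"
    using assms by (simp add: ennreal_of_nat_eq_real_of_nat ennreal_mult)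
  finally show ?thesis .
qed

context frostman_points
begin

text \<open>Some \<open>a\<close> does no worse than the average. Averaging contributes one power of
  the total mass, and \<open>card_bins_bound\<close> the other two.\<close>

lemma exists_spread_projection:
  assumes E: "(\<Sum>a\<in>I. w a * (\<Sum>y\<in>I. \<Sum>z\<in>I. w y * w z * exp (- (p a \<bullet> (p y - p z))\<^sup>2 / (2 * d\<^sup>2)))) \<le> E * d"
    and pos: "0 < sum w I"
  obtains a where "a \<in> I"
    "(sum w I) ^ 3 \<le> exp (1/2) * E * (real (card ((\<lambda>y. \<lfloor>(p a \<bullet> p y) / d\<rfloor>) ` I)) * d)"
proof -
  define \<Phi> where "\<Phi> a = (\<Sum>y\<in>I. \<Sum>z\<in>I. w y * w z * exp (- (p a \<bullet> (p y - p z))\<^sup>2 / (2 * d\<^sup>2)))" for a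
  have "\<exists>a\<in>I. \<Phi> a * sum w I \<le> E * d"
  proof (rule ccontr)
    assume "\<not> ?thesis"
    then have neg: "\<And>a. a \<in> I \<Longrightarrow> E * d < \<Phi> a * sum w I" by force
    \<comment> \<open>An atom of positive weight makes the averaged inequality strict.\<close>
    obtain b where b: "b \<in> I" "0 < w b"
      using pos w by (metis less_eq_real_def less_irrefl sum.neutral)
    have "sum w I * (E * d) = (\<Sum>a\<in>I. w a * (E * d))" by (simp add: sum_distrib_right)
    also have "\<dots> < (\<Sum>a\<in>I. w a * (\<Phi> a * sum w I))"
    proof (rule sum_strict_mono_ex1[OF fin])
      show "\<forall>a\<in>I. w a * (E * d) \<le> w a * (\<Phi> a * sum w I)"
        by (intro ballI mult_left_mono w less_imp_le[OF neg])
      show "\<exists>a\<in>I. w a * (E * d) < w a * (\<Phi> a * sum w I)"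
        using b neg by (intro bexI[of _ b] mult_strict_left_mono) auto
    qed
    also have "\<dots> = sum w I * (\<Sum>a\<in>I. w a * \<Phi> a)" by (simp add: sum_distrib_left mult_ac)
    also have "\<dots> \<le> sum w I * (E * d)" using E pos by (intro mult_left_mono) (auto simp: \<Phi>_def)
    finally show False by simp
  qed
  then obtain a where a: "a \<in> I" "\<Phi> a * sum w I \<le> E * d" ..
  let ?N = "real (card ((\<lambda>y. \<lfloor>(p a \<bullet> p y) / d\<rfloor>) ` I))"
  have "(sum w I)\<^sup>2 \<le> ?N * (exp (1/2) * \<Phi> a)"
    using card_bins_bound[OF fin w d(1), where t = "\<lambda>y. p a \<bullet> p y"] unfolding \<Phi>_def by (simp add: inner_diff_right)
  then have "(sum w I)\<^sup>2 * sum w I \<le> ?N * (exp (1/2) * \<Phi> a) * sum w I"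
    using pos by (intro mult_right_mono) auto
  also have "\<dots> = ?N * exp (1/2) * (\<Phi> a * sum w I)" by (simp add: mult_ac)
  also have "\<dots> \<le> ?N * exp (1/2) * (E * d)" using a by (intro mult_left_mono) auto
  finally show ?thesis using that a by (simp add: power3_eq_cube power2_eq_square mult_ac)
qed

end

text \<open>Let \<open>b\<close> be a limit of the directions. If the projection along
  \<open>b\<close> were null, an open set of measure below \<open>\<eta>\<close> would contain a
  whole neighbourhood of it, by compactness. For late \<open>k\<close> that neighbourhood contains
  all bins, of total length at least \<open>\<eta>\<close>.\<close>

lemma emeasure_dot_image_pos_limit:
  fixes K :: "'a::euclidean_space set"
  assumes K: "compact K" and \<eta>: "0 < \<eta>" and d: "\<And>k. 0 < d k" "d \<longlonglongrightarrow> 0"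
    and spread: "\<And>k. \<exists>a\<in>K. \<exists>P. finite P \<and> P \<subseteq> K \<and> \<eta> \<le> real (card ((\<lambda>y. \<lfloor>(a \<bullet> y) / d k\<rfloor>) ` P)) * d k"
  obtains a where "a \<in> K" "0 < emeasure lborel (dot_image a K)"
proof -
  obtain a P where a: "\<And>k. a k \<in> K" and P: "\<And>k. finite (P k)" "\<And>k. P k \<subseteq> K"
    "\<And>k. \<eta> \<le> real (card ((\<lambda>y. \<lfloor>(a k \<bullet> y) / d k\<rfloor>) ` P k)) * d k"
    using spread by metis
  obtain b r where b: "b \<in> K" "strict_mono (r :: nat \<Rightarrow> nat)" "(a \<circ> r) \<longlonglongrightarrow> b"
    using seq_compactE[OF compact_imp_seq_compact[OF K], of a] a by blast
  obtain R where R: "0 < R" "\<And>y. y \<in> K \<Longrightarrow> norm y \<le> R"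
    using compact_imp_bounded[OF K] bounded_pos by blast
  have cK: "compact (dot_image b K)" by (rule compact_dot_image[OF K])
  have "emeasure lborel (dot_image b K) \<noteq> 0"
  proof
    assume 0: "emeasure lborel (dot_image b K) = 0"
    have Kb: "dot_image b K \<in> sets borel" using cK by (intro borel_closed compact_imp_closed)
    obtain U where U: "open U" "dot_image b K \<subseteq> U" "emeasure lborel (U - dot_image b K) < \<eta>"
      using outer_regular_lborel[OF Kb \<eta>] .
    have "emeasure lborel U \<le> emeasure lborel (dot_image b K) + emeasure lborel (U - dot_image b K)"
      using U Kb by (subst plus_emeasure) (auto intro!: emeasure_mono)
    then have U\<eta>: "emeasure lborel U < \<eta>" using U(3) 0 by (simp add: order_le_less_trans)
    obtain e where e: "0 < e" "(\<Union>x\<in>dot_image b K. ball x e) \<subseteq> U"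
      using compact_subset_open_imp_ball_epsilon_subset[OF cK U(1,2)] by blast
    have "(\<lambda>k. dist (a (r k)) b * R + d (r k)) \<longlonglongrightarrow> 0 * R + 0"
    proof (intro tendsto_add tendsto_mult tendsto_const)
      show "(\<lambda>k. dist (a (r k)) b) \<longlonglongrightarrow> 0"
        using iffD1[OF tendsto_dist_iff b(3)] by (simp only: o_def)
      show "(\<lambda>k. d (r k)) \<longlonglongrightarrow> 0"
        using LIMSEQ_subseq_LIMSEQ[OF d(2) b(2)] by (simp only: o_def)
    qed
    then have "\<forall>\<^sub>F k in sequentially. dist (a (r k)) b * R + d (r k) < e"
      using e(1) by (intro order_tendstoD(2)) auto
    then obtain k where k: "dist (a (r k)) b * R + d (r k) < e"
      by (auto dest: eventually_happens)
    define J where "J = (\<lambda>y. \<lfloor>(a (r k) \<bullet> y) / d (r k)\<rfloor>) ` P (r k)"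
    have finJ: "finite J" using P(1) by (simp add: J_def)
    have "(\<Union>j\<in>J. {of_int j * d (r k) ..< (of_int j + 1) * d (r k)}) \<subseteq> U"
    proof
      fix t assume "t \<in> (\<Union>j\<in>J. {of_int j * d (r k) ..< (of_int j + 1) * d (r k)})"
      then obtain y where y: "y \<in> P (r k)"
        "of_int \<lfloor>(a (r k) \<bullet> y) / d (r k)\<rfloor> * d (r k) \<le> t" "t < (of_int \<lfloor>(a (r k) \<bullet> y) / d (r k)\<rfloor> + 1) * d (r k)"
        unfolding J_def by auto
      let ?u = "(a (r k) \<bullet> y) / d (r k)"
      have "of_int \<lfloor>?u\<rfloor> * d (r k) \<le> ?u * d (r k)" "?u * d (r k) \<le> (of_int \<lfloor>?u\<rfloor> + 1) * d (r k)"
        using d(1)[of "r k"] by (intro mult_right_mono; linarith)+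
      moreover have "?u * d (r k) = a (r k) \<bullet> y" using d(1)[of "r k"] by simp
      ultimately have "\<bar>t - a (r k) \<bullet> y\<bar> \<le> d (r k)"
        using y by (auto simp: abs_le_iff algebra_simps)
      moreover have "\<bar>a (r k) \<bullet> y - b \<bullet> y\<bar> \<le> dist (a (r k)) b * R"
      proof -
        have yK: "y \<in> K" using y(1) P(2) by blast
        have "\<bar>(a (r k) - b) \<bullet> y\<bar> \<le> norm (a (r k) - b) * norm y" by (rule Cauchy_Schwarz_ineq2)
        also have "\<dots> \<le> norm (a (r k) - b) * R" using R(2)[OF yK] by (intro mult_left_mono) auto
        finally show ?thesis by (simp add: inner_diff_left dist_norm)
      qed
      ultimately have "dist (b \<bullet> y) t < e" using k by (simp add: dist_real_def)
      moreover have "b \<bullet> y \<in> dot_image b K" using y(1) P(2) by (auto simp: dot_image_eq)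
      ultimately have "t \<in> (\<Union>x\<in>dot_image b K. ball x e)" by (auto simp del: dist_real_def)
      then show "t \<in> U" using e(2) by (rule subsetD[rotated])
    qed
    then have "emeasure lborel (\<Union>j\<in>J. {of_int j * d (r k) ..< (of_int j + 1) * d (r k)}) \<le> emeasure lborel U"
      using U(1) by (intro emeasure_mono) auto
    then have "ennreal (real (card J) * d (r k)) < ennreal \<eta>"
      unfolding emeasure_bins[OF finJ d(1)] using U\<eta> by (rule order_le_less_trans)
    then have "real (card J) * d (r k) < \<eta>" by (simp add: ennreal_less_iff d(1) less_imp_le)
    then show False using P(3)[of "r k"] by (simp add: J_def)
  qed
  then show ?thesis using that[OF b(1)] by (simp add: zero_less_iff_neq_zero)
qed

text \<open>Below the dimension, the premeasure is nonzero at some scale \<open>d\<close>. Once all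
  cells have diameter at most \<open>d\<close>, every cover by cells competes in that premeasure, so
  the content is positive; countable subadditivity localises it to one coarsest cell.\<close>

lemma exists_positive_content:
  fixes A :: "(real ^ 'n) set"
  assumes "ennreal s < hausdorff_dim A" "0 < s"
  obtains \<sigma> z where "1 \<le> \<sigma>" "0 < cell_content \<sigma> s (A \<inter> cell \<sigma> 0 z)"
proof -
  have "hausdorff_measure s A \<noteq> 0"
  proof
    assume "hausdorff_measure s A = 0"
    then have "hausdorff_dim A \<le> ennreal s"
      unfolding hausdorff_dim_def using assms(2) by (intro Inf_lower) auto
    then show False using assms(1) by simp
  qed
  then obtain d where d: "0 < d" "hausdorff_premeasure s d A \<noteq> 0"
    unfolding hausdorff_measure_def by (metis (no_types, lifting) SUP_eq_const SUP_bot_conv(1) bot_ennreal greaterThan_iff)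
  \<comment> \<open>The second term makes even the coarsest cells no wider than \<open>d\<close>;
    \<open>1 \<le> \<sigma>\<close> later keeps the scales \<open>1 / (\<sigma> * 2 ^ k)\<close> at
    most 1.\<close>
  define \<sigma> where "\<sigma> = max 1 (real CARD('n) / d)"
  have \<sigma>: "1 \<le> \<sigma>" "real CARD('n) / \<sigma> \<le> d"
  proof -
    show "1 \<le> \<sigma>" by (simp add: \<sigma>_def)
    have "real CARD('n) / d \<le> \<sigma>" by (simp add: \<sigma>_def)
    then show "real CARD('n) / \<sigma> \<le> d" using d \<open>1 \<le> \<sigma>\<close> by (simp add: field_simps)
  qed
  have cnt: "countable (cells \<sigma> :: (real ^ 'n) set set)"
  proof -
    have "cells \<sigma> = (\<lambda>(k, z). cell \<sigma> k z) ` (UNIV :: (nat \<times> ('n \<Rightarrow> int)) set)"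
      by (auto simp: cells_def)
    then show ?thesis by simp
  qed
  have "hausdorff_premeasure s d A \<le> cell_content \<sigma> s A"
    unfolding net_content_def
  proof (rule INF_greatest)
    fix \<U> assume U: "\<U> \<in> {\<U>. \<U> \<subseteq> cells \<sigma> \<and> A \<subseteq> \<Union> \<U>}"
    show "hausdorff_premeasure s d A \<le> emeasure (diam_measure s) \<U>"
    proof (rule hausdorff_premeasure_le_diam_measure)
      show "countable \<U>" using U cnt by (auto intro: countable_subset)
      fix Q assume "Q \<in> \<U>"
      then obtain k z where Q: "Q = cell \<sigma> k z" using U by (auto simp: cells_def)
      have "diameter Q \<le> real CARD('n) / (\<sigma> * 2 ^ k)" unfolding Q using \<sigma> by (intro diameter_cell_le) auto
      also have "\<dots> \<le> real CARD('n) / \<sigma>" using \<sigma>(1) by (intro divide_left_mono) auto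
      finally show "bounded Q \<and> diameter Q \<le> d" using \<sigma> unfolding Q by (auto intro: bounded_cell)
    qed (use U d in auto)
  qed
  then have pos: "cell_content \<sigma> s A \<noteq> 0" using d(2) by (auto simp: zero_less_iff_neq_zero)
  have "\<exists>z. cell_content \<sigma> s (A \<inter> cell \<sigma> 0 z) \<noteq> 0"
  proof (rule ccontr)
    assume neg: "\<not> ?thesis"
    let ?z = "from_nat :: nat \<Rightarrow> 'n \<Rightarrow> int"
    have "A = (\<Union>i. A \<inter> cell \<sigma> 0 (?z i))"
    proof (intro equalityI subsetI)
      fix x assume "x \<in> A"
      then have "x \<in> A \<inter> cell \<sigma> 0 (?z (to_nat (cell_key \<sigma> 0 x)))" by (simp add: cell_def)
      then show "x \<in> (\<Union>i. A \<inter> cell \<sigma> 0 (?z i))" by blast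
    qed auto
    then have "cell_content \<sigma> s A \<le> (\<Sum>i. cell_content \<sigma> s (A \<inter> cell \<sigma> 0 (?z i)))"
      using net_content_UN_le[of "diam_measure s" "cells \<sigma>" "\<lambda>i. A \<inter> cell \<sigma> 0 (?z i)"] by simp
    then show False using neg pos by simp
  qed
  then show ?thesis using that \<sigma>(1) by (auto simp: zero_less_iff_neq_zero)
qed

theorem theorem1p14:
  fixes A :: "(real ^ 'n) set"
  assumes "CARD('n) \<ge> 2"
    and "A \<in> sets borel"
    and "hausdorff_dim A > ennreal ((real CARD('n) + 1) / 2)"
  shows "\<exists>a\<in>A. emeasure lebesgue (dot_image a A) > 0"
proof -
  obtain s where s: "(real CARD('n) + 1) / 2 < s" "ennreal s < hausdorff_dim A"
  proof -
    obtain c where c: "ennreal ((real CARD('n) + 1) / 2) < c" "c < hausdorff_dim A"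
      using dense[OF assms(3)] by auto
    then obtain s where "c = ennreal s" "0 \<le> s" by (cases c) auto
    then show ?thesis using that[of s] c by (simp add: ennreal_less_iff)
  qed
  have dim: "real DIM(real ^ 'n) + 1 < 2 * s" using s(1) by simp
  have s0: "0 < s" using s(1) by (smt (verit) divide_nonneg_nonneg of_nat_0_le_iff)
  obtain \<sigma> z0 where \<sigma>: "1 \<le> \<sigma>" and pos: "0 < cell_content \<sigma> s (A \<inter> cell \<sigma> 0 z0)"
    by (rule exists_positive_content[OF s(2) s0])
  have \<sigma>0: "0 < \<sigma>" using \<sigma> by simp
  let ?Q = "cell \<sigma> 0 z0"
  \<comment> \<open>Neighbourhoods of \<open>K\<close> may leave the cell, while
    \<open>frostman_discrete\<close> starts from a set inside one coarsest cell; intersecting with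
    \<open>?Q\<close> also keeps the content finite.\<close>
  define c where "c E = cell_content \<sigma> s (E \<inter> ?Q)" for E
  have cle: "c E \<le> ennreal ((real CARD('n) / (\<sigma> * 2 ^ 0)) powr s)" for E
    unfolding c_def by (rule cell_content_cell_le[OF \<sigma>0 s0]) auto
  obtain l where l: "0 < l" "l < c (A \<inter> ?Q)" using dense[OF pos] by (auto simp: c_def Int_assoc)
  have bA: "bounded (A \<inter> ?Q)" using bounded_cell[OF \<sigma>0] by (rule bounded_subset) auto
  have mA: "A \<inter> ?Q \<in> sets borel" using assms(2) borel_cell by auto
  obtain K where K: "compact K" "K \<subseteq> A \<inter> ?Q" "\<And>V. open V \<Longrightarrow> K \<subseteq> V \<Longrightarrow> l < c V"
  proof (rule capacitability[of c "A \<inter> ?Q" "closure (A \<inter> ?Q)" l])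
    fix E F :: "(real ^ 'n) set" assume "E \<subseteq> F"
    then show "c E \<le> c F" unfolding c_def by (intro net_content_mono) auto
  next
    fix E :: "nat \<Rightarrow> (real ^ 'n) set" and l
    assume E: "incseq E" "l < c (\<Union>i. E i)"
    have "incseq (\<lambda>i. E i \<inter> ?Q)" using E(1) by (auto simp: incseq_def)
    then have "c (\<Union>i. E i) \<le> (SUP i. c (E i))"
      unfolding c_def Int_UN_distrib2[symmetric] UN_extend_simps
      by (intro net_content_incseq finite_supercells \<sigma>0 cells_nested) auto
    then show "\<exists>i. l < c (E i)" using E(2) by (metis less_SUP_iff order_less_le_trans)
  qed (use l bA analytic_borel[OF mA] in \<open>auto intro: closure_subset[THEN subsetD]\<close>)
  obtain R where R: "\<And>x. x \<in> K \<Longrightarrow> norm x \<le> R"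
    using compact_imp_bounded[OF K(1)] bounded_iff by blast
  define m where "m = (real CARD('n) / \<sigma>) powr s"
  define C where "C = 9 ^ CARD('n) * real CARD('n) powr s"
  \<comment> \<open>The constant of \<open>energy_le\<close> without its factor \<open>d\<close>,
    written out to show that it is the same at all scales.\<close>
  define E where "E = exp (2 * R\<^sup>2) * (sqrt 8 ^ CARD('n) * exp (R\<^sup>2 / 4) * (C * gauss_const s + m) * (m * (C * gauss_const s))
      * exp (2 * s\<^sup>2) * (LBINT t. max 1 \<bar>t\<bar> powr (- (2 * s - real CARD('n))))) / sqrt (2 * pi)"
  define u where "u = enn2real l"
  have lfin: "l < top" using l(2) cle[of "A \<inter> ?Q"] by (meson ennreal_less_top order_le_less_trans order_less_trans)
  have u: "0 < u" "l = ennreal u" using l(1) lfin by (auto simp: u_def enn2real_positive_iff)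
  define d where "d k = 1 / (\<sigma> * 2 ^ k)" for k :: nat
  have d: "0 < d k" "d k \<le> 1" for k
  proof -
    have "1 * 1 \<le> \<sigma> * 2 ^ k" using \<sigma> by (intro mult_mono) auto
    then show "0 < d k" "d k \<le> 1" using \<sigma> by (auto simp: d_def)
  qed
  have step: "\<exists>a\<in>K. \<exists>P. finite P \<and> P \<subseteq> K \<and>
      u ^ 3 \<le> exp (1/2) * E * (real (card ((\<lambda>y. \<lfloor>(a \<bullet> y) / d k\<rfloor>) ` P)) * d k)" for k
  proof -
    \<comment> \<open>Capacitability bounds the content of open neighbourhoods of \<open>K\<close>
      only, so the mass is taken from the \<open>d k\<close>-neighbourhood and its atoms are moved
      into \<open>K\<close>.\<close>
    define V where "V = (\<Union>x\<in>K. ball x (d k))"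
    have "l < c V" using d unfolding V_def by (intro K(3)) auto
    then have lc: "u < enn2real (cell_content \<sigma> s (V \<inter> ?Q))"
      using cle[of V] u unfolding c_def
      by (cases "cell_content \<sigma> s (V \<inter> ?Q)") (auto simp: ennreal_less_iff top_unique)
    obtain I :: "('n \<Rightarrow> int) set" and w p where I: "finite I" "\<And>z. z \<in> I \<Longrightarrow> 0 \<le> w z" "\<And>z. z \<in> I \<Longrightarrow> p z \<in> K"
      "sum w I = enn2real (cell_content \<sigma> s (V \<inter> ?Q))"
      "\<And>x r. 1 / (\<sigma> * 2 ^ k) \<le> r \<Longrightarrow>
        (\<Sum>z | z \<in> I \<and> norm (p z - x) \<le> r. w z) \<le> 9 ^ CARD('n) * real CARD('n) powr s * r powr s"
      by (rule frostman_discrete[OF \<sigma>0 s0, of "V \<inter> ?Q" z0 K k]) (auto simp: V_def d_def intro: less_imp_le)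
    interpret frostman_points I p w R C m s "d k"
    proof
      show "sum w I \<le> m" unfolding I(4) m_def using cle[of V] by (intro enn2real_leI) (auto simp: c_def)
      show "\<And>x r. d k \<le> r \<Longrightarrow> (\<Sum>i | i \<in> I \<and> norm (p i - x) \<le> r. w i) \<le> C * r powr s"
        unfolding d_def C_def by (rule I(5))
    qed (use I R s0 d in \<open>auto simp: C_def\<close>)
    have lw: "u < sum w I" using lc I(4) by simp
    have "(\<Sum>a\<in>I. w a * (\<Sum>y\<in>I. \<Sum>z\<in>I. w y * w z * exp (- (p a \<bullet> (p y - p z))\<^sup>2 / (2 * (d k)\<^sup>2)))) \<le> E * d k"
      using energy_le[OF dim] unfolding spectral_const_def E_def by simp
    then obtain a where a: "a \<in> I"
      "(sum w I) ^ 3 \<le> exp (1/2) * E * (real (card ((\<lambda>y. \<lfloor>(p a \<bullet> p y) / d k\<rfloor>) ` I)) * d k)"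
      using lw u by (elim exists_spread_projection) auto
    have "u ^ 3 \<le> (sum w I) ^ 3" using lw u by (intro power_mono) auto
    also note a(2)
    also have "(\<lambda>y. \<lfloor>(p a \<bullet> p y) / d k\<rfloor>) ` I = (\<lambda>y. \<lfloor>(p a \<bullet> y) / d k\<rfloor>) ` (p ` I)" by auto
    finally show ?thesis using a(1) I(1,3) by (intro bexI[of _ "p a"] exI[of _ "p ` I"]) auto
  qed
  \<comment> \<open>Positivity of \<open>E\<close> is read off from \<open>step\<close>, whose
    left-hand side is positive.\<close>
  have E0: "0 < E"
  proof (rule ccontr)
    assume "\<not> 0 < E"
    from step[of 0] obtain a :: "real ^ 'n" and P where
      "u ^ 3 \<le> exp (1/2) * E * (real (card ((\<lambda>y. \<lfloor>(a \<bullet> y) / d 0\<rfloor>) ` P)) * d 0)" by blast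
    also have "\<dots> \<le> 0"
      using \<open>\<not> 0 < E\<close> d(1)[of 0] by (intro mult_nonpos_nonneg mult_nonneg_nonpos) auto
    finally have "u ^ 3 \<le> 0" .
    moreover have "0 < u ^ 3" using u(1) by simp
    ultimately show False by simp
  qed
  obtain a where a: "a \<in> K" "0 < emeasure lborel (dot_image a K)"
  proof (rule emeasure_dot_image_pos_limit[OF K(1), of "u ^ 3 / (exp (1/2) * E)" d])
    show "d \<longlonglongrightarrow> 0" unfolding d_def using \<sigma>0 by real_asymp
    show "\<exists>a\<in>K. \<exists>P. finite P \<and> P \<subseteq> K \<and>
      u ^ 3 / (exp (1/2) * E) \<le> real (card ((\<lambda>y. \<lfloor>(a \<bullet> y) / d k\<rfloor>) ` P)) * d k" for k
      using step[of k] E0 by (simp add: pos_divide_le_eq mult_ac)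
  qed (use u E0 d in auto)
  have "dot_image a K \<in> sets borel"
    using K(1) by (intro borel_closed compact_imp_closed compact_dot_image)
  then have "0 < emeasure lebesgue (dot_image a K)" using a(2) by simp
  also have "\<dots> \<le> emeasure lebesgue (dot_image a A)"
    using K(2) lebesgue_dot_image[OF assms(2), of a] by (intro emeasure_mono) (auto simp: dot_image_eq)
  finally show ?thesis using a(1) K(2) by blast
qed

end
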